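(* There is an absolute constant $c>0$ such that for every $n \ge 2$ and every graph $H$ on $n$ vertices with at least one edge, \[ Q(f_H) \ge c\sqrt{\alpha_H \cdot n}. \]
   Context: Graphs are simple and undirected. For a fixed graph $H$ on vertex set $[n]=\{1,\dots,n\}$ (isolated vertices allowed), $f_H:\{0,1\}^{\binom{n}{2}}\to\{0,1\}$ takes as input a graph $G$ on vertex set $[n]$, given by its $\binom n2$ edge-indicator bits, and $f_H(G)=1$ iff $H$ is isomorphic to a (not necessarily induced) subgraph of $G$. $Q(f)$ denotes the bounded-error (success probability at least $2/3$ on every input) quantum query complexity of a Boolean function $f$, where a query to the input $x$ reveals one bit $x_i$ (standard phase/oracle query model). $\alpha_H$ denotes the size of a maximum independent set of $H$. *)

theory Defs
  imports Complex_Main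
begin

text \<open>Inputs are Boolean strings x indexed by a finite index set I (values of x outside I
are irrelevant). The state space is spanned by basis states (q, w) where q is the query
register (None = no query, Some i = query bit i, for i in I) and w < k is a workspace
register. Operators are given by their matrices over this basis.\<close>

type_synonym 'a qbasis = "'a option \<times> nat"
type_synonym 'a qvec = "'a qbasis \<Rightarrow> complex"
type_synonym 'a qop = "'a qbasis \<Rightarrow> 'a qbasis \<Rightarrow> complex"

definition qbasis :: "'a set \<Rightarrow> nat \<Rightarrow> 'a qbasis set" where
  "qbasis I k = (insert None (Some ` I)) \<times> {..<k}"

definition qapply :: "'a set \<Rightarrow> nat \<Rightarrow> 'a qop \<Rightarrow> 'a qvec \<Rightarrow> 'a qvec" where
  "qapply I k U v = (\<lambda>b. \<Sum>b'\<in>qbasis I k. U b b' * v b')"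

definition qunitary :: "'a set \<Rightarrow> nat \<Rightarrow> 'a qop \<Rightarrow> bool" where
  "qunitary I k U \<longleftrightarrow>
     (\<forall>b1\<in>qbasis I k. \<forall>b2\<in>qbasis I k.
        (\<Sum>b\<in>qbasis I k. cnj (U b b1) * U b b2) = (if b1 = b2 then 1 else 0))"

definition qoracle :: "('a \<Rightarrow> bool) \<Rightarrow> 'a qvec \<Rightarrow> 'a qvec" where
  "qoracle x v = (\<lambda>(q, w). (case q of None \<Rightarrow> 1 | Some i \<Rightarrow> (if x i then -1 else 1)) * v (q, w))"

definition qinit :: "'a qvec" where
  "qinit = (\<lambda>b. if b = (None, 0) then 1 else 0)"

fun qstate :: "'a set \<Rightarrow> nat \<Rightarrow> (nat \<Rightarrow> 'a qop) \<Rightarrow> ('a \<Rightarrow> bool) \<Rightarrow> nat \<Rightarrow> 'a qvec" where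
  "qstate I k U x 0 = qapply I k (U 0) qinit"
| "qstate I k U x (Suc t) = qapply I k (U (Suc t)) (qoracle x (qstate I k U x t))"

definition qaccept :: "'a set \<Rightarrow> nat \<Rightarrow> (nat \<Rightarrow> 'a qop) \<Rightarrow> 'a qbasis set \<Rightarrow> nat \<Rightarrow> ('a \<Rightarrow> bool) \<Rightarrow> real" where
  "qaccept I k U S T x = (\<Sum>b\<in>S. (cmod (qstate I k U x T b))\<^sup>2)"

definition qcomputes :: "'a set \<Rightarrow> (('a \<Rightarrow> bool) \<Rightarrow> bool) \<Rightarrow> nat \<Rightarrow> bool" where
  "qcomputes I f T \<longleftrightarrow>
     (\<exists>k U S. k > 0 \<and> (\<forall>t\<le>T. qunitary I k (U t)) \<and> S \<subseteq> qbasis I k \<and>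
        (\<forall>x. (f x \<longrightarrow> qaccept I k U S T x \<ge> 2/3) \<and>
             (\<not> f x \<longrightarrow> qaccept I k U S T x \<le> 1/3)))"

definition Qcomplexity :: "'a set \<Rightarrow> (('a \<Rightarrow> bool) \<Rightarrow> bool) \<Rightarrow> nat" where
  "Qcomplexity I f = (LEAST T. qcomputes I f T)"

text \<open>Possible edges: 2-element subsets of {0..<n}; a graph is a subset of these.\<close>
definition all_edges :: "nat \<Rightarrow> nat set set" where
  "all_edges n = {e. \<exists>u v. u < n \<and> v < n \<and> u \<noteq> v \<and> e = {u, v}}"

text \<open>f_H: input x gives edge indicators of G (edge e present iff x e);
  true iff H is isomorphic to a subgraph of G (both on n vertices).\<close>
definition f_sub :: "nat \<Rightarrow> nat set set \<Rightarrow> (nat set \<Rightarrow> bool) \<Rightarrow> bool" where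
  "f_sub n H x \<longleftrightarrow>
     (\<exists>\<phi>. inj_on \<phi> {..<n} \<and> \<phi> ` {..<n} \<subseteq> {..<n} \<and>
          (\<forall>u<n. \<forall>v<n. {u, v} \<in> H \<longrightarrow> x {\<phi> u, \<phi> v}))"

definition indep_number :: "nat \<Rightarrow> nat set set \<Rightarrow> nat" where
  "indep_number n H = Max {card S | S. S \<subseteq> {..<n} \<and> (\<forall>u\<in>S. \<forall>v\<in>S. {u, v} \<notin> H)}"

end

theory Submission
  imports Defs
begin

text \<open>Let \<open>A\<close> be a maximum independent set of \<open>H\<close>, of size \<open>\<alpha>\<close>, let \<open>r = n - \<alpha>\<close>, and let \<open>d\<close> be the least
  number of neighbours in \<open>A\<close> of a vertex outside \<open>A\<close>. A graph with an independent set of size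
  \<open>\<alpha> + 1\<close> does not contain \<open>H\<close>, whereas \<open>r - 1\<close> vertices joined to everything together with one
  further vertex of degree \<open>d\<close> into the rest do contain \<open>H\<close>. The adversary method then gives the
  bound in each of three cases.

  \<^item> Graphs spanned by \<open>r\<close>, respectively \<open>r - 1\<close>, vertices joined to everything differ by the choice
    of one vertex among \<open>r\<close>, respectively \<open>\<alpha> + 1\<close>; this gives \<open>\<Omega>(sqrt (r \<alpha>))\<close>, which suffices
    unless \<open>r < \<alpha> / 4\<close>.
  \<^item> If \<open>r < \<alpha> / 4\<close> and \<open>d \<ge> \<alpha> / 2\<close>, take a clique of about \<open>\<alpha> / 4\<close> vertices and let
    each of its vertices miss exactly \<open>\<alpha> - d + 1\<close> vertices of an independent set. This graph does not
    contain \<open>H\<close>, but adding any missing edge of the clique vertices creates a vertex of degree \<open>d\<close>.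
  \<^item> If \<open>r < \<alpha> / 4\<close> and \<open>d < \<alpha> / 2\<close>, choose the star sizes of a star forest on \<open>\<alpha> + 1\<close>
    vertices greedily, each as large as possible without creating \<open>H\<close>. Then every additional leaf at any
    centre creates \<open>H\<close>, and weighting a pair by the size of the star that grows gives \<open>\<Omega>(\<alpha>)\<close>.\<close>

section \<open>The adversary bound\<close>

definition qip :: "'a set \<Rightarrow> nat \<Rightarrow> 'a qvec \<Rightarrow> 'a qvec \<Rightarrow> complex" where
  "qip I k u v = (\<Sum>b\<in>qbasis I k. cnj (u b) * v b)"

definition qnorm2 :: "'a set \<Rightarrow> nat \<Rightarrow> 'a qvec \<Rightarrow> real" where
  "qnorm2 I k v = (\<Sum>b\<in>qbasis I k. (cmod (v b))\<^sup>2)"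

lemma finite_qbasis: "finite I \<Longrightarrow> finite (qbasis I k)"
  by (simp add: qbasis_def)

lemma qip_self: "qip I k v v = of_real (qnorm2 I k v)"
  unfolding qip_def qnorm2_def of_real_sum
  by (intro sum.cong refl) (metis complex_norm_square mult.commute)

lemma qip_unitary:
  assumes "finite I" and U: "qunitary I k U"
  shows "qip I k (qapply I k U u) (qapply I k U v) = qip I k u v"
proof -
  let ?B = "qbasis I k"
  have fin: "finite ?B" using assms(1) by (rule finite_qbasis)
  have "qip I k (qapply I k U u) (qapply I k U v)
      = (\<Sum>b\<in>?B. \<Sum>b1\<in>?B. \<Sum>b2\<in>?B. cnj (u b1) * v b2 * (cnj (U b b1) * U b b2))"
    unfolding qip_def qapply_def cnj_sum sum_product
    by (intro sum.cong refl) (simp add: mult_ac)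
  also have "\<dots> = (\<Sum>b1\<in>?B. \<Sum>b2\<in>?B. \<Sum>b\<in>?B. cnj (u b1) * v b2 * (cnj (U b b1) * U b b2))"
    by (subst sum.swap, rule sum.cong[OF refl], subst sum.swap, rule refl)
  also have "\<dots> = (\<Sum>b1\<in>?B. \<Sum>b2\<in>?B. cnj (u b1) * v b2 * (if b1 = b2 then 1 else 0))"
    using U unfolding qunitary_def by (intro sum.cong refl) (simp flip: sum_distrib_left)
  also have "\<dots> = qip I k u v"
    unfolding qip_def using fin
    by (intro sum.cong refl) (simp add: if_distrib[of "(*) _"] cong: if_cong)
  finally show ?thesis .
qed

lemma qnorm2_unitary:
  assumes "finite I" "qunitary I k U"
  shows "qnorm2 I k (qapply I k U v) = qnorm2 I k v"
  using qip_unitary[OF assms, of v v] by (simp add: qip_self)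

lemma cmod_qoracle: "cmod (qoracle x v b) = cmod (v b)"
  by (cases b) (auto simp: qoracle_def norm_mult split: option.splits)

lemma qnorm2_qinit:
  assumes "finite I" "k > 0"
  shows "qnorm2 I k qinit = 1"
proof -
  have mem: "(None, 0) \<in> qbasis I k" using assms(2) by (simp add: qbasis_def)
  have "qnorm2 I k qinit = (\<Sum>b\<in>qbasis I k. if b = (None, 0) then 1 else 0)"
    unfolding qnorm2_def qinit_def by (intro sum.cong refl) simp
  then show ?thesis using mem finite_qbasis[OF assms(1)] by simp
qed

lemma qnorm2_qstate:
  assumes "finite I" "k > 0" "\<forall>s\<le>t. qunitary I k (U s)"
  shows "qnorm2 I k (qstate I k U x t) = 1"
  using assms(3)
proof (induction t)
  case 0
  then show ?case using assms by (simp add: qnorm2_unitary qnorm2_qinit)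
next
  case (Suc t)
  have "qnorm2 I k (qoracle x (qstate I k U x t)) = qnorm2 I k (qstate I k U x t)"
    by (simp add: qnorm2_def cmod_qoracle)
  with Suc show ?case using assms(1) by (simp add: qnorm2_unitary)
qed

definition qdiffer :: "('a \<Rightarrow> bool) \<Rightarrow> ('a \<Rightarrow> bool) \<Rightarrow> 'a qbasis \<Rightarrow> bool" where
  "qdiffer x y b \<longleftrightarrow> (case fst b of None \<Rightarrow> False | Some i \<Rightarrow> x i \<noteq> y i)"

text \<open>Oracle phases are signs, so they cancel on every basis state whose queried bit agrees in
  \<open>x\<close> and \<open>y\<close>. Where the bits differ the term changes sign, which costs
  twice its real part.\<close>

lemma qip_qoracle_bound:
  assumes "finite I"
  shows "Re (qip I k u v) - Re (qip I k (qoracle x u) (qoracle y v))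
    \<le> 2 * (\<Sum>b\<in>qbasis I k. if qdiffer x y b then cmod (u b) * cmod (v b) else 0)"
proof -
  have "Re (cnj (u b) * v b) - Re (cnj (qoracle x u b) * qoracle y v b)
     \<le> 2 * (if qdiffer x y b then cmod (u b) * cmod (v b) else 0)" for b
  proof (cases "qdiffer x y b")
    case False
    then have "cnj (qoracle x u b) * qoracle y v b = cnj (u b) * v b"
      by (cases b) (auto simp: qoracle_def qdiffer_def split: option.splits)
    with False show ?thesis by simp
  next
    case True
    then have "cnj (qoracle x u b) * qoracle y v b = - (cnj (u b) * v b)"
      by (cases b) (auto simp: qoracle_def qdiffer_def split: option.splits)
    moreover have "Re (cnj (u b) * v b) \<le> cmod (u b) * cmod (v b)"
      using complex_Re_le_cmod[of "cnj (u b) * v b"] by (simp add: norm_mult)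
    ultimately show ?thesis using True by simp
  qed
  then show ?thesis
    unfolding qip_def Re_sum sum_distrib_left sum_subtractf[symmetric] by (intro sum_mono)
qed

text \<open>AM-GM with the ratio 3/4, close to the optimal \<open>1 / sqrt 2\<close>, on the accepting
  and on the rejecting basis states separately.\<close>
lemma qip_accept_gap:
  assumes "finite I" "S \<subseteq> qbasis I k" "qnorm2 I k u = 1" "qnorm2 I k v = 1"
    and u: "(\<Sum>b\<in>S. (cmod (u b))\<^sup>2) \<ge> 2/3" and v: "(\<Sum>b\<in>S. (cmod (v b))\<^sup>2) \<le> 1/3"
  shows "Re (qip I k u v) \<le> 17/18"
proof -
  let ?B = "qbasis I k"
  have fin: "finite ?B" using assms(1) by (rule finite_qbasis)
  define pu where "pu = (\<Sum>b\<in>S. (cmod (u b))\<^sup>2)"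
  define pv where "pv = (\<Sum>b\<in>S. (cmod (v b))\<^sup>2)"
  have amgm: "a * b \<le> (3/8) * a\<^sup>2 + (2/3) * b\<^sup>2" for a b :: real
  proof -
    have "0 \<le> (3 * a - 4 * b)\<^sup>2" by simp
    then show ?thesis by (simp add: power2_eq_square algebra_simps)
  qed
  have split: "sum g ?B = sum g S + sum g (?B - S)" for g :: "'a qbasis \<Rightarrow> real"
    using sum.subset_diff[OF assms(2) fin, of g] by simp
  have ru: "(\<Sum>b\<in>?B - S. (cmod (u b))\<^sup>2) = 1 - pu"
    and rv: "(\<Sum>b\<in>?B - S. (cmod (v b))\<^sup>2) = 1 - pv"
    using assms(3,4) split unfolding qnorm2_def pu_def pv_def by (simp_all add: algebra_simps)
  have "Re (qip I k u v) \<le> (\<Sum>b\<in>?B. cmod (u b) * cmod (v b))"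
    unfolding qip_def Re_sum
  proof (rule sum_mono)
    fix b show "Re (cnj (u b) * v b) \<le> cmod (u b) * cmod (v b)"
      using complex_Re_le_cmod[of "cnj (u b) * v b"] by (simp add: norm_mult)
  qed
  also have "\<dots> = (\<Sum>b\<in>S. cmod (u b) * cmod (v b)) + (\<Sum>b\<in>?B - S. cmod (u b) * cmod (v b))"
    by (rule split)
  also have "(\<Sum>b\<in>S. cmod (u b) * cmod (v b)) \<le> (\<Sum>b\<in>S. (3/8) * (cmod (u b))\<^sup>2 + (2/3) * (cmod (v b))\<^sup>2)"
    by (intro sum_mono amgm)
  also have "\<dots> = (3/8) * pu + (2/3) * pv"
    by (simp add: sum.distrib sum_distrib_left pu_def pv_def)
  also have "(\<Sum>b\<in>?B - S. cmod (u b) * cmod (v b))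
      \<le> (\<Sum>b\<in>?B - S. (3/8) * (cmod (v b))\<^sup>2 + (2/3) * (cmod (u b))\<^sup>2)"
    using amgm by (intro sum_mono) (metis mult.commute)
  also have "\<dots> = (3/8) * (1 - pv) + (2/3) * (1 - pu)"
    unfolding sum.distrib sum_distrib_left[symmetric] ru rv by simp
  finally have "Re (qip I k u v) \<le> 3/8 * pu + 2/3 * pv + (3/8 * (1 - pv) + 2/3 * (1 - pu))"
    by simp
  \<comment> \<open>The bound equals 25/24 - (7/24) (pu - pv), and \<open>pu - pv\<close> is at
    least 1/3, which gives 17/18.\<close>
  then show ?thesis using u v unfolding pu_def[symmetric] pv_def[symmetric] by argo
qed

text \<open>The weighted inner product \<open>W\<close> of the states on \<open>X p\<close> and
  \<open>Y q\<close> equals the total weight before the first query, must fall to at most 17/18 of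
  it, and drops per query by at most the sum of all \<open>A p\<close> and \<open>B q\<close>.
  Splitting \<open>w\<close> into \<open>a\<close> and \<open>b\<close> charges the two sides of a
  pair separately.\<close>

theorem weighted_adversary_bound:
  fixes X :: "'p \<Rightarrow> 'a \<Rightarrow> bool" and Y :: "'q \<Rightarrow> 'a \<Rightarrow> bool" and w a b :: "'p \<Rightarrow> 'q \<Rightarrow> real"
  assumes fin: "finite I" "finite P" "finite Q" and comp: "qcomputes I f T"
    and one: "\<And>p. p \<in> P \<Longrightarrow> f (X p)" and zero: "\<And>q. q \<in> Q \<Longrightarrow> \<not> f (Y q)"
    and nonneg: "\<And>p q. w p q \<ge> 0" "\<And>p q. a p q \<ge> 0" "\<And>p q. b p q \<ge> 0"
    and prod: "\<And>p q. (w p q)\<^sup>2 \<le> a p q * b p q"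
    and rowsum: "\<And>p i. p \<in> P \<Longrightarrow> i \<in> I \<Longrightarrow> (\<Sum>q\<in>Q. if X p i \<noteq> Y q i then a p q else 0) \<le> A p"
    and colsum: "\<And>q i. q \<in> Q \<Longrightarrow> i \<in> I \<Longrightarrow> (\<Sum>p\<in>P. if X p i \<noteq> Y q i then b p q else 0) \<le> B q"
    and bounds: "\<And>p. p \<in> P \<Longrightarrow> A p \<ge> 0" "\<And>q. q \<in> Q \<Longrightarrow> B q \<ge> 0"
  shows "(\<Sum>p\<in>P. \<Sum>q\<in>Q. w p q) \<le> 18 * real T * ((\<Sum>p\<in>P. A p) + (\<Sum>q\<in>Q. B q))"
proof -
  obtain k U S where k: "k > 0" and U: "\<forall>t\<le>T. qunitary I k (U t)" and S: "S \<subseteq> qbasis I k"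
    and acc: "\<And>x. (f x \<longrightarrow> qaccept I k U S T x \<ge> 2/3) \<and> (\<not> f x \<longrightarrow> qaccept I k U S T x \<le> 1/3)"
    using comp unfolding qcomputes_def by blast
  let ?B = "qbasis I k"
  let ?M = "(\<Sum>p\<in>P. A p) + (\<Sum>q\<in>Q. B q)"
  define \<psi> where "\<psi> x t = qstate I k U x t" for x t
  define W where "W t = (\<Sum>p\<in>P. \<Sum>q\<in>Q. w p q * Re (qip I k (\<psi> (X p) t) (\<psi> (Y q) t)))" for t
  have norm1: "qnorm2 I k (\<psi> x t) = 1" if "t \<le> T" for x t
    unfolding \<psi>_def using qnorm2_qstate[OF fin(1) k, of t U x] U that by simp
  have step: "W t - W (Suc t) \<le> ?M" if t: "Suc t \<le> T" for t
  proof -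
    define u where "u p b = cmod (\<psi> (X p) t b)" for p b
    define v where "v q b = cmod (\<psi> (Y q) t b)" for q b
    \<comment> \<open>AM-GM for \<open>sqrt (a p q) * c\<close> and \<open>sqrt (b p q) * d\<close>,
      whose product dominates \<open>w p q * (c * d)\<close> by \<open>prod\<close>.\<close>
    have amgm: "2 * (w p q * (c * d)) \<le> a p q * c\<^sup>2 + b p q * d\<^sup>2" if "c \<ge> 0" "d \<ge> 0" for p q c d
    proof -
      have "w p q \<le> sqrt (a p q) * sqrt (b p q)"
        using prod[of p q] by (metis real_le_rsqrt real_sqrt_mult)
      then have "w p q * (c * d) \<le> (sqrt (a p q) * sqrt (b p q)) * (c * d)"
        using that by (intro mult_right_mono) auto
      moreover have "0 \<le> (sqrt (a p q) * c - sqrt (b p q) * d)\<^sup>2" by simp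
      then have "2 * ((sqrt (a p q) * sqrt (b p q)) * (c * d)) \<le> (sqrt (a p q) * c)\<^sup>2 + (sqrt (b p q) * d)\<^sup>2"
        by (simp add: power2_diff mult_ac)
      then have "2 * ((sqrt (a p q) * sqrt (b p q)) * (c * d)) \<le> a p q * c\<^sup>2 + b p q * d\<^sup>2"
        using nonneg by (simp add: power_mult_distrib)
      ultimately show ?thesis by linarith
    qed
    have drop: "w p q * Re (qip I k (\<psi> (X p) t) (\<psi> (Y q) t))
        - w p q * Re (qip I k (\<psi> (X p) (Suc t)) (\<psi> (Y q) (Suc t)))
      \<le> (\<Sum>b\<in>?B. (if qdiffer (X p) (Y q) b then a p q else 0) * (u p b)\<^sup>2)
        + (\<Sum>c\<in>?B. (if qdiffer (X p) (Y q) c then b p q else 0) * (v q c)\<^sup>2)" for p q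
    proof -
      have "qip I k (\<psi> (X p) (Suc t)) (\<psi> (Y q) (Suc t))
          = qip I k (qoracle (X p) (\<psi> (X p) t)) (qoracle (Y q) (\<psi> (Y q) t))"
        using U t by (simp add: \<psi>_def qip_unitary[OF fin(1)])
      then have "w p q * (Re (qip I k (\<psi> (X p) t) (\<psi> (Y q) t)) - Re (qip I k (\<psi> (X p) (Suc t)) (\<psi> (Y q) (Suc t))))
        \<le> w p q * (2 * (\<Sum>b\<in>?B. if qdiffer (X p) (Y q) b then u p b * v q b else 0))"
        using qip_qoracle_bound[OF fin(1), of k "\<psi> (X p) t" "\<psi> (Y q) t" "X p" "Y q"]
        by (intro mult_left_mono nonneg) (simp add: u_def v_def cong: if_cong)
      also have "\<dots> = (\<Sum>b\<in>?B. if qdiffer (X p) (Y q) b then 2 * (w p q * (u p b * v q b)) else 0)"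
        by (simp add: sum_distrib_left if_distrib mult_ac cong: if_cong)
      also have "\<dots> \<le> (\<Sum>c\<in>?B. (if qdiffer (X p) (Y q) c then a p q else 0) * (u p c)\<^sup>2
          + (if qdiffer (X p) (Y q) c then b p q else 0) * (v q c)\<^sup>2)"
        by (intro sum_mono) (auto intro!: amgm simp: u_def v_def)
      finally show ?thesis by (simp add: sum.distrib right_diff_distrib)
    qed
    have "W t - W (Suc t) \<le> (\<Sum>p\<in>P. \<Sum>q\<in>Q.
        (\<Sum>b\<in>?B. (if qdiffer (X p) (Y q) b then a p q else 0) * (u p b)\<^sup>2)
        + (\<Sum>c\<in>?B. (if qdiffer (X p) (Y q) c then b p q else 0) * (v q c)\<^sup>2))"
      unfolding W_def sum_subtractf[symmetric] by (intro sum_mono drop)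
    also have "\<dots> = (\<Sum>p\<in>P. \<Sum>c\<in>?B. (\<Sum>q\<in>Q. if qdiffer (X p) (Y q) c then a p q else 0) * (u p c)\<^sup>2)
        + (\<Sum>q\<in>Q. \<Sum>c\<in>?B. (\<Sum>p\<in>P. if qdiffer (X p) (Y q) c then b p q else 0) * (v q c)\<^sup>2)"
    proof -
      have "(\<Sum>p\<in>P. \<Sum>q\<in>Q. \<Sum>c\<in>?B. (if qdiffer (X p) (Y q) c then a p q else 0) * (u p c)\<^sup>2)
         = (\<Sum>p\<in>P. \<Sum>c\<in>?B. \<Sum>q\<in>Q. (if qdiffer (X p) (Y q) c then a p q else 0) * (u p c)\<^sup>2)"
        by (rule sum.cong[OF refl], rule sum.swap)
      moreover have "(\<Sum>p\<in>P. \<Sum>q\<in>Q. \<Sum>c\<in>?B. (if qdiffer (X p) (Y q) c then b p q else 0) * (v q c)\<^sup>2)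
         = (\<Sum>q\<in>Q. \<Sum>c\<in>?B. \<Sum>p\<in>P. (if qdiffer (X p) (Y q) c then b p q else 0) * (v q c)\<^sup>2)"
        by (subst sum.swap, rule sum.cong[OF refl], rule sum.swap)
      ultimately show ?thesis by (simp add: sum.distrib sum_distrib_right)
    qed
    also have "\<dots> \<le> (\<Sum>p\<in>P. \<Sum>c\<in>?B. A p * (u p c)\<^sup>2) + (\<Sum>q\<in>Q. \<Sum>c\<in>?B. B q * (v q c)\<^sup>2)"
    proof (intro add_mono sum_mono mult_right_mono zero_le_power2)
      \<comment> \<open>At \<open>None\<close> no bit is queried and the inner sum is 0; there
        \<open>bounds\<close> takes the place of \<open>rowsum\<close>, and likewise of
        \<open>colsum\<close> below.\<close>
      fix p c assume "p \<in> P" "c \<in> ?B"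
      then show "(\<Sum>q\<in>Q. if qdiffer (X p) (Y q) c then a p q else 0) \<le> A p"
        using rowsum[of p] bounds(1)[of p] by (cases c; cases "fst c") (auto simp: qdiffer_def qbasis_def)
    next
      fix q c assume "q \<in> Q" "c \<in> ?B"
      then show "(\<Sum>p\<in>P. if qdiffer (X p) (Y q) c then b p q else 0) \<le> B q"
        using colsum[of q] bounds(2)[of q] by (cases c; cases "fst c") (auto simp: qdiffer_def qbasis_def)
    qed
    also have "\<dots> = ?M"
      using norm1[of t] t unfolding qnorm2_def u_def v_def by (simp add: sum_distrib_left[symmetric])
    finally show ?thesis .
  qed
  have tele: "W 0 - W t \<le> real t * ?M" if "t \<le> T" for t
    using that
  proof (induction t)
    case (Suc t)
    then show ?case using step[of t] by (simp add: algebra_simps)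
  qed simp
  \<comment> \<open>Before the first query the state does not depend on the input, so every inner
    product is 1.\<close>
  have start: "W 0 = (\<Sum>p\<in>P. \<Sum>q\<in>Q. w p q)"
  proof -
    have "\<psi> x 0 = \<psi> y 0" for x y by (simp add: \<psi>_def)
    then have "qip I k (\<psi> x 0) (\<psi> y 0) = 1" for x y
      using norm1[of 0 x] by (metis le0 qip_self of_real_1)
    then show ?thesis by (simp add: W_def)
  qed
  have fin_ip: "W T \<le> 17/18 * (\<Sum>p\<in>P. \<Sum>q\<in>Q. w p q)"
  proof -
    have "w p q * Re (qip I k (\<psi> (X p) T) (\<psi> (Y q) T)) \<le> 17/18 * w p q" if "p \<in> P" "q \<in> Q" for p q
    proof -
      have "Re (qip I k (\<psi> (X p) T) (\<psi> (Y q) T)) \<le> 17/18"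
        using acc one[OF that(1)] zero[OF that(2)] norm1[of T]
        by (intro qip_accept_gap[OF fin(1) S]) (auto simp: qaccept_def \<psi>_def)
      then show ?thesis using mult_left_mono[OF _ nonneg(1)[of p q]] by fastforce
    qed
    then show ?thesis unfolding W_def sum_distrib_left by (intro sum_mono)
  qed
  show ?thesis using tele[of T] start fin_ip by simp
qed

text \<open>Ambainis' unweighted form. Related pairs get weight 1, split as \<open>s\<close> and
  \<open>1 / s\<close>; double counting the \<open>N\<close> related pairs bounds the sizes of
  \<open>P\<close> and \<open>Q\<close> by \<open>N / m\<close> and \<open>N / m'\<close>, after
  which \<open>N\<close> cancels.\<close>

theorem adversary_bound:
  fixes X :: "'p \<Rightarrow> 'a \<Rightarrow> bool" and Y :: "'q \<Rightarrow> 'a \<Rightarrow> bool" and R :: "'p \<Rightarrow> 'q \<Rightarrow> bool"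
    and m m' l l' :: real
  assumes fin: "finite I" "finite P" "finite Q" and comp: "qcomputes I f T"
    and one: "\<And>p. p \<in> P \<Longrightarrow> f (X p)" and zero: "\<And>q. q \<in> Q \<Longrightarrow> \<not> f (Y q)"
    and pos: "P \<noteq> {}" "m > 0" "m' > 0" "l > 0" "l' > 0"
    and m: "\<And>p. p \<in> P \<Longrightarrow> real (card {q\<in>Q. R p q}) \<ge> m"
    and m': "\<And>q. q \<in> Q \<Longrightarrow> real (card {p\<in>P. R p q}) \<ge> m'"
    and l: "\<And>p i. p \<in> P \<Longrightarrow> i \<in> I \<Longrightarrow> real (card {q\<in>Q. R p q \<and> X p i \<noteq> Y q i}) \<le> l"
    and l': "\<And>q i. q \<in> Q \<Longrightarrow> i \<in> I \<Longrightarrow> real (card {p\<in>P. R p q \<and> X p i \<noteq> Y q i}) \<le> l'"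
  shows "sqrt (m * m' / (l * l')) \<le> 36 * real T"
proof -
  \<comment> \<open>This value makes \<open>s * l / m\<close> and \<open>l' / (m' * s)\<close>
    equal, which minimises their sum; both become \<open>1 / g\<close> below.\<close>
  define s where "s = sqrt (l' * m / (l * m'))"
  define N where "N = (\<Sum>p\<in>P. \<Sum>q\<in>Q. if R p q then 1 else 0 :: real)"
  have s: "s > 0" unfolding s_def using pos by simp
  have card_eq: "(\<Sum>q\<in>Q. if R p q then 1 else 0 :: real) = real (card {q\<in>Q. R p q})" for p
    using fin by (simp add: sum.If_cases Int_def)
  have card_eq': "(\<Sum>p\<in>P. if R p q then 1 else 0 :: real) = real (card {p\<in>P. R p q})" for q
    using fin by (simp add: sum.If_cases Int_def)
  have N1: "real (card P) * m \<le> N"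
    unfolding N_def card_eq using sum_mono[of P "\<lambda>_. m"] m by simp
  have N2: "real (card Q) * m' \<le> N"
    unfolding N_def by (subst sum.swap) (use sum_mono[of Q "\<lambda>_. m'"] m' in \<open>simp add: card_eq'\<close>)
  have Npos: "N > 0"
    using N1 pos fin by (meson card_gt_0_iff less_le_trans mult_pos_pos of_nat_0_less_iff)
  have "N \<le> 18 * real T * ((\<Sum>p\<in>P. s * l) + (\<Sum>q\<in>Q. l' / s))"
    unfolding N_def
  proof (rule weighted_adversary_bound[where X = X and Y = Y and w = "\<lambda>p q. if R p q then 1 else 0"
        and A = "\<lambda>_. s * l" and B = "\<lambda>_. l' / s"
        and a = "\<lambda>p q. if R p q then s else 0" and b = "\<lambda>p q. if R p q then 1 / s else 0",
        OF fin comp one zero])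
    fix p i assume "p \<in> P" "i \<in> I"
    then have "s * real (card {q\<in>Q. R p q \<and> X p i \<noteq> Y q i}) \<le> s * l"
      using l s by (intro mult_left_mono) auto
    moreover have "(\<Sum>q\<in>Q. if X p i \<noteq> Y q i then if R p q then s else 0 else 0)
       = (\<Sum>q\<in>{q\<in>Q. R p q \<and> X p i \<noteq> Y q i}. s)"
      unfolding sum.inter_filter[OF fin(3)] by (intro sum.cong) auto
    ultimately show "(\<Sum>q\<in>Q. if X p i \<noteq> Y q i then if R p q then s else 0 else 0) \<le> s * l"
      by (simp add: mult.commute)
  next
    fix q i assume "q \<in> Q" "i \<in> I"
    then have "(1/s) * real (card {p\<in>P. R p q \<and> X p i \<noteq> Y q i}) \<le> (1/s) * l'"
      using l' s by (intro mult_left_mono) auto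
    moreover have "(\<Sum>p\<in>P. if X p i \<noteq> Y q i then if R p q then 1/s else 0 else 0)
       = (\<Sum>p\<in>{p\<in>P. R p q \<and> X p i \<noteq> Y q i}. 1/s)"
      unfolding sum.inter_filter[OF fin(2)] by (intro sum.cong) auto
    ultimately show "(\<Sum>p\<in>P. if X p i \<noteq> Y q i then if R p q then 1/s else 0 else 0) \<le> l' / s"
      by (simp add: mult.commute)
  qed (use s pos in auto)
  also have "\<dots> = 18 * real T * (real (card P) * s * l + real (card Q) * l' / s)"
    by simp
  also have "\<dots> \<le> 18 * real T * ((N / m) * s * l + (N / m') * l' / s)"
    using N1 N2 pos s by (intro mult_left_mono add_mono mult_right_mono divide_right_mono)
      (auto simp: field_simps)
  also have "\<dots> = N * (18 * real T * (s * l / m + l' / (m' * s)))"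
    using s pos by (simp add: field_simps)
  finally have "N * 1 \<le> N * (18 * real T * (s * l / m + l' / (m' * s)))" by simp
  then have le: "1 \<le> 18 * real T * (s * l / m + l' / (m' * s))"
    using Npos by (simp only: mult_le_cancel_left_pos)
  define g where "g = sqrt (m * m' / (l * l'))"
  have g: "g > 0" unfolding g_def using pos by simp
  have sg: "s * g = m / l" and s_g: "s / g = l' / m'"
    unfolding s_def g_def real_sqrt_mult[symmetric] real_sqrt_divide[symmetric]
    using pos by (intro real_sqrt_unique; simp add: field_simps power2_eq_square)+
  have "s * l / m = 1 / g" using sg g pos by (simp add: field_simps)
  moreover have "l' / (m' * s) = 1 / g" using s_g g s pos by (simp add: field_simps)
  ultimately have "1 \<le> 36 * real T / g" using le by simp
  then show ?thesis unfolding g_def[symmetric] using g by (simp add: field_simps)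
qed

section \<open>An exact algorithm for every function\<close>

definition qket :: "'a qbasis \<Rightarrow> 'a qvec" where
  "qket b0 = (\<lambda>b. if b = b0 then 1 else 0)"

text \<open>With an involution \<open>\<tau>\<close> of the basis, this operator acts on each orbit of \<open>\<tau>\<close>
  separately; both permutations of order two and blockwise Hadamard gates have this form.\<close>
definition paired_op ::
    "('a qbasis \<Rightarrow> 'a qbasis) \<Rightarrow> ('a qbasis \<Rightarrow> real) \<Rightarrow> ('a qbasis \<Rightarrow> real) \<Rightarrow> 'a qop" where
  "paired_op \<tau> \<alpha> \<beta> =
     (\<lambda>b b'. of_real (if b = b' then \<alpha> b' else 0) + of_real (if b = \<tau> b' then \<beta> b' else 0))"

text \<open>Columns from different orbits of \<open>\<tau>\<close> have disjoint supports; within an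
  orbit of size two, \<open>norm\<close> and \<open>orth\<close> say that the two columns are
  orthonormal. On a fixed point \<open>orth\<close> reads 2 \<alpha> \<beta> = 0, so the single
  entry \<alpha> + \<beta> has square 1.\<close>

lemma qunitary_paired_op:
  assumes "finite I" and \<tau>: "\<And>b. b \<in> qbasis I k \<Longrightarrow> \<tau> b \<in> qbasis I k"
    and inv: "\<And>b. b \<in> qbasis I k \<Longrightarrow> \<tau> (\<tau> b) = b"
    and norm: "\<And>b. b \<in> qbasis I k \<Longrightarrow> (\<alpha> b)\<^sup>2 + (\<beta> b)\<^sup>2 = 1"
    and orth: "\<And>b. b \<in> qbasis I k \<Longrightarrow> \<alpha> (\<tau> b) * \<beta> b + \<beta> (\<tau> b) * \<alpha> b = 0"
  shows "qunitary I k (paired_op \<tau> \<alpha> \<beta>)"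
  unfolding qunitary_def
proof (intro ballI)
  let ?B = "qbasis I k"
  fix b1 b2 assume b: "b1 \<in> ?B" "b2 \<in> ?B"
  have fin: "finite ?B" using assms(1) by (rule finite_qbasis)
  let ?D = "\<lambda>b c d. (if b = c then d else 0 :: real)"
  have delta: "(\<Sum>b\<in>?B. ?D b c x * ?D b d y) = (if c = d then x * y else 0)" if "c \<in> ?B" for c d x y
  proof -
    have "(\<Sum>b\<in>?B. ?D b c x * ?D b d y) = (\<Sum>b\<in>?B. ?D b c (if c = d then x * y else 0))"
      by (intro sum.cong) auto
    then show ?thesis using fin that by simp
  qed
  have "(\<Sum>b\<in>?B. cnj (paired_op \<tau> \<alpha> \<beta> b b1) * paired_op \<tau> \<alpha> \<beta> b b2)
     = of_real (\<Sum>b\<in>?B. (?D b b1 (\<alpha> b1) + ?D b (\<tau> b1) (\<beta> b1)) * (?D b b2 (\<alpha> b2) + ?D b (\<tau> b2) (\<beta> b2)))"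
    unfolding paired_op_def of_real_sum by (intro sum.cong refl) simp
  also have "(\<Sum>b\<in>?B. (?D b b1 (\<alpha> b1) + ?D b (\<tau> b1) (\<beta> b1)) * (?D b b2 (\<alpha> b2) + ?D b (\<tau> b2) (\<beta> b2)))
     = (if b1 = b2 then \<alpha> b1 * \<alpha> b2 else 0) + (if b1 = \<tau> b2 then \<alpha> b1 * \<beta> b2 else 0)
      + (if \<tau> b1 = b2 then \<beta> b1 * \<alpha> b2 else 0) + (if \<tau> b1 = \<tau> b2 then \<beta> b1 * \<beta> b2 else 0)"
    unfolding distrib_left distrib_right sum.distrib using b \<tau> by (simp only: delta)
  also have "\<dots> = (if b1 = b2 then 1 else 0)"
  proof (cases "b1 = b2")
    case True
    then show ?thesis using norm[OF b(1)] orth[OF b(1)]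
      by (auto simp: power2_eq_square mult.commute)
  next
    case False
    then have "\<tau> b1 \<noteq> \<tau> b2" and "\<tau> b1 = b2 \<longleftrightarrow> b1 = \<tau> b2" using inv b by metis+
    then show ?thesis using False orth[OF b(2)] by auto
  qed
  finally show "(\<Sum>b\<in>?B. cnj (paired_op \<tau> \<alpha> \<beta> b b1) * paired_op \<tau> \<alpha> \<beta> b b2) = (if b1 = b2 then 1 else 0)"
    by simp
qed

lemma qapply_paired_op_ket:
  assumes "finite I" "b0 \<in> qbasis I k"
  shows "qapply I k (paired_op \<tau> \<alpha> \<beta>) (qket b0)
    = (\<lambda>b. of_real (\<alpha> b0) * qket b0 b + of_real (\<beta> b0) * qket (\<tau> b0) b)"
proof
  fix b
  have "qapply I k (paired_op \<tau> \<alpha> \<beta>) (qket b0) b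
     = (\<Sum>b'\<in>qbasis I k. if b' = b0 then paired_op \<tau> \<alpha> \<beta> b b0 else 0)"
    unfolding qapply_def qket_def by (intro sum.cong) auto
  then show "qapply I k (paired_op \<tau> \<alpha> \<beta>) (qket b0) b
    = of_real (\<alpha> b0) * qket b0 b + of_real (\<beta> b0) * qket (\<tau> b0) b"
    using assms finite_qbasis[OF assms(1)] by (simp add: paired_op_def qket_def)
qed

lemma qapply_add: "qapply I k U (\<lambda>b. u b + v b) = (\<lambda>b. qapply I k U u b + qapply I k U v b)"
  by (simp add: qapply_def sum.distrib distrib_left)

lemma qapply_scale: "qapply I k U (\<lambda>b. c * u b) = (\<lambda>b. c * qapply I k U u b)"
  by (simp add: qapply_def sum_distrib_left mult_ac)

lemma qoracle_add: "qoracle x (\<lambda>b. u b + v b) = (\<lambda>b. qoracle x u b + qoracle x v b)"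
  by (auto simp: qoracle_def fun_eq_iff distrib_left)

lemma qoracle_scale: "qoracle x (\<lambda>b. c * u b) = (\<lambda>b. c * qoracle x u b)"
  by (auto simp: qoracle_def fun_eq_iff)

lemma qoracle_ket:
  "qoracle x (qket (None, w)) = qket (None, w)"
  "qoracle x (qket (Some i, w)) = (\<lambda>b. (if x i then -1 else 1) * qket (Some i, w) b)"
  by (auto simp: qoracle_def qket_def fun_eq_iff split: option.splits)

definition swap_query :: "'a \<Rightarrow> 'a qbasis \<Rightarrow> 'a qbasis" where
  "swap_query i b = (case b of (None, w) \<Rightarrow> (Some i, w)
     | (Some j, w) \<Rightarrow> if j = i then (None, w) else (Some j, w))"

definition hadamard_query :: "'a \<Rightarrow> 'a qop" where
  "hadamard_query i = paired_op (swap_query i)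
     (\<lambda>b. if swap_query i b = b then 1 else if fst b = None then 1 / sqrt 2 else - (1 / sqrt 2))
     (\<lambda>b. if swap_query i b = b then 0 else 1 / sqrt 2)"

lemma qunitary_hadamard_query:
  assumes "finite I" "i \<in> I"
  shows "qunitary I k (hadamard_query i)"
  unfolding hadamard_query_def
proof (rule qunitary_paired_op[OF assms(1)])
  fix b :: "'a qbasis" assume b: "b \<in> qbasis I k"
  show "swap_query i b \<in> qbasis I k"
    using b assms(2) by (auto simp: qbasis_def swap_query_def split: option.splits)
  show inv: "swap_query i (swap_query i b) = b"
    by (auto simp: swap_query_def split: option.splits prod.splits if_splits)
  show "(if swap_query i b = b then 1 else if fst b = None then 1 / sqrt 2 else - (1 / sqrt 2))\<^sup>2
      + (if swap_query i b = b then 0 else 1 / sqrt 2)\<^sup>2 = (1 :: real)"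
    by (simp add: power_divide)
  show "(if swap_query i (swap_query i b) = swap_query i b then 1
        else if fst (swap_query i b) = None then 1 / sqrt 2 else - (1 / sqrt 2))
      * (if swap_query i b = b then 0 else 1 / sqrt 2)
      + (if swap_query i (swap_query i b) = swap_query i b then 0 else 1 / sqrt 2)
      * (if swap_query i b = b then 1 else if fst b = None then 1 / sqrt 2 else - (1 / sqrt 2)) = (0 :: real)"
    unfolding inv
    by (auto simp: swap_query_def real_div_sqrt split: option.splits prod.splits if_splits)
qed

text \<open>Phase kickback: the oracle flips the sign of \<open>Some i\<close> in the uniform
  superposition exactly when \<open>x i\<close> holds, and the second Hadamard gate turns this
  relative phase into a basis state.\<close>

lemma hadamard_query_twice:
  assumes "finite I" "i \<in> I" "w < k"
  shows "qapply I k (hadamard_query i) (qoracle x (qapply I k (hadamard_query i) (qket (None, w))))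
    = qket (if x i then Some i else None, w)"
proof -
  define h where "h = complex_of_real (1 / sqrt 2)"
  have mem: "(None, w) \<in> qbasis I k" "(Some i, w) \<in> qbasis I k" using assms by (auto simp: qbasis_def)
  have h: "h * h = 1/2" by (simp add: h_def flip: of_real_mult)
  have None: "qapply I k (hadamard_query i) (qket (None, w))
      = (\<lambda>b. h * qket (None, w) b + h * qket (Some i, w) b)"
    unfolding hadamard_query_def qapply_paired_op_ket[OF assms(1) mem(1)]
    by (simp add: swap_query_def h_def)
  have Some: "qapply I k (hadamard_query i) (qket (Some i, w))
      = (\<lambda>b. - h * qket (Some i, w) b + h * qket (None, w) b)"
    unfolding hadamard_query_def qapply_paired_op_ket[OF assms(1) mem(2)]
    by (simp add: swap_query_def h_def)
  show ?thesis
  proof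
    fix b
    have "qapply I k (hadamard_query i) (qoracle x (qapply I k (hadamard_query i) (qket (None, w)))) b
      = h * h * (qket (None, w) b + qket (Some i, w) b)
        + (if x i then -1 else 1) * (h * h) * (qket (None, w) b - qket (Some i, w) b)"
      unfolding None qoracle_add qoracle_scale qoracle_ket qapply_add qapply_scale Some
      by (simp add: algebra_simps)
    then show "qapply I k (hadamard_query i) (qoracle x (qapply I k (hadamard_query i) (qket (None, w)))) b
      = qket (if x i then Some i else None, w) b"
      unfolding h by (cases "x i") (simp_all add: algebra_simps)
  qed
qed

definition store_swap :: "('a set \<Rightarrow> nat) \<Rightarrow> (nat \<Rightarrow> 'a set) \<Rightarrow> 'a \<Rightarrow> 'a qbasis \<Rightarrow> 'a qbasis" where
  "store_swap enc dec i b = (case b of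
      (None, w) \<Rightarrow> if i \<in> dec w then (Some i, enc (dec w - {i})) else (None, w)
    | (Some j, w) \<Rightarrow> if j = i \<and> i \<notin> dec w then (None, enc (insert i (dec w))) else (Some j, w))"

definition store_op :: "('a set \<Rightarrow> nat) \<Rightarrow> (nat \<Rightarrow> 'a set) \<Rightarrow> 'a \<Rightarrow> 'a qop" where
  "store_op enc dec i = paired_op (store_swap enc dec i)
     (\<lambda>b. if store_swap enc dec i b = b then 1 else 0) (\<lambda>b. if store_swap enc dec i b = b then 0 else 1)"

lemma qunitary_store_op:
  assumes "finite I" "i \<in> I"
    and enc: "\<And>S. S \<subseteq> I \<Longrightarrow> enc S < k \<and> dec (enc S) = S"
    and dec: "\<And>w. w < k \<Longrightarrow> dec w \<subseteq> I \<and> enc (dec w) = w"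
  shows "qunitary I k (store_op enc dec i)"
  unfolding store_op_def
proof (rule qunitary_paired_op[OF assms(1)])
  fix b :: "'a qbasis" assume b: "b \<in> qbasis I k"
  obtain q w where bq: "b = (q, w)" and w: "w < k" and q: "q = None \<or> (\<exists>j\<in>I. q = Some j)"
    using b by (auto simp: qbasis_def)
  have ins: "enc (insert i (dec w)) < k" "dec (enc (insert i (dec w))) = insert i (dec w)"
    and del: "enc (dec w - {i}) < k" "dec (enc (dec w - {i})) = dec w - {i}"
    using enc[of "insert i (dec w)"] enc[of "dec w - {i}"] dec[OF w] assms(2) by auto
  show "store_swap enc dec i b \<in> qbasis I k"
    using q w ins del assms(2) by (auto simp: bq qbasis_def store_swap_def split: option.splits)
  show inv: "store_swap enc dec i (store_swap enc dec i b) = b"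
    using q dec[OF w] ins del
    by (auto simp: bq store_swap_def insert_absorb split: option.splits)
  show "(if store_swap enc dec i b = b then 1 else 0)\<^sup>2 + (if store_swap enc dec i b = b then 0 else 1)\<^sup>2 = (1 :: real)"
    by simp
  show "(if store_swap enc dec i (store_swap enc dec i b) = store_swap enc dec i b then 1 else 0)
      * (if store_swap enc dec i b = b then 0 else 1)
      + (if store_swap enc dec i (store_swap enc dec i b) = store_swap enc dec i b then 0 else 1)
      * (if store_swap enc dec i b = b then 1 else 0) = (0 :: real)"
    unfolding inv by auto
qed

lemma store_op_ket:
  assumes "finite I" "i \<in> I" "S \<subseteq> I" "i \<notin> S"
    and enc: "\<And>S. S \<subseteq> I \<Longrightarrow> enc S < k \<and> dec (enc S) = S"
  shows "qapply I k (store_op enc dec i) (qket (None, enc S)) = qket (None, enc S)"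
    and "qapply I k (store_op enc dec i) (qket (Some i, enc S)) = qket (None, enc (insert i S))"
proof -
  have mem: "(None, enc S) \<in> qbasis I k" "(Some i, enc S) \<in> qbasis I k"
    using assms enc[of S] by (auto simp: qbasis_def)
  show "qapply I k (store_op enc dec i) (qket (None, enc S)) = qket (None, enc S)"
    unfolding store_op_def qapply_paired_op_ket[OF assms(1) mem(1)]
    using enc[of S] assms(3,4) by (simp add: store_swap_def)
  show "qapply I k (store_op enc dec i) (qket (Some i, enc S)) = qket (None, enc (insert i S))"
    unfolding store_op_def qapply_paired_op_ket[OF assms(1) mem(2)]
    using enc[of S] assms(3,4) by (simp add: store_swap_def)
qed

text \<open>The bits are read one at a time with three queries each: two of them, conjugated by a
  Hadamard gate, move bit \<open>i\<close> into the query register, and the third one is idle up to a sign.\<close>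
theorem qcomputes_exhaustive:
  assumes fin: "finite I" and dep: "\<And>x y. (\<And>i. i \<in> I \<Longrightarrow> x i = y i) \<Longrightarrow> f x = f y"
  shows "qcomputes I f (3 * card I)"
proof -
  obtain e where e: "bij_betw e {..<card I} I"
    using ex_bij_betw_nat_finite[OF fin] by (auto simp: atLeast0LessThan)
  define k where "k = card (Pow I)"
  obtain enc where enc_bij: "bij_betw enc (Pow I) {..<k}"
    using ex_bij_betw_finite_nat[of "Pow I"] fin by (auto simp: atLeast0LessThan k_def)
  define dec where "dec = inv_into (Pow I) enc"
  have enc: "enc S < k \<and> dec (enc S) = S" if "S \<subseteq> I" for S
    using enc_bij that bij_betw_apply[OF enc_bij, of S] bij_betw_inv_into_left[OF enc_bij, of S]
    by (simp add: dec_def)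
  have dec: "dec w \<subseteq> I \<and> enc (dec w) = w" if "w < k" for w
    using that bij_betw_apply[OF bij_betw_inv_into[OF enc_bij], of w]
      bij_betw_inv_into_right[OF enc_bij, of w] by (simp add: dec_def)
  have k: "k > 0" using enc[of "{}"] by auto
  text \<open>The code of the empty set need not be the initial workspace state 0.\<close>
  define \<tau>0 :: "'a qbasis \<Rightarrow> 'a qbasis" where
    "\<tau>0 b = (if b = (None, 0) then (None, enc {}) else if b = (None, enc {}) then (None, 0) else b)" for b
  \<comment> \<open>For bit number \<open>j\<close> the gates at times 3j+1 and 3j+2 are Hadamard
    gates and the gate at 3j+3 stores the bit, hence the offset \<open>t - 1\<close>.\<close>
  define U :: "nat \<Rightarrow> 'a qop" where
    "U t = (if t = 0 then paired_op \<tau>0 (\<lambda>b. 0) (\<lambda>b. 1)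
       else if (t - 1) mod 3 = 2 then store_op enc dec (e ((t - 1) div 3))
       else hadamard_query (e ((t - 1) div 3)))" for t
  define S :: "'a qbasis set" where "S = {(None, enc A) | A. A \<subseteq> I \<and> f (\<lambda>i. i \<in> A)}"
  define red where "red x j = {i. \<exists>j'<j. i = e j' \<and> x i}" for x :: "'a \<Rightarrow> bool" and j
  have ej: "e j \<in> I" if "j < card I" for j using e that by (auto simp: bij_betw_def)
  have unit: "qunitary I k (U t)" if "t \<le> 3 * card I" for t
  proof (cases "t = 0")
    case True
    have "qunitary I k (paired_op \<tau>0 (\<lambda>b. 0) (\<lambda>b. 1))"
      by (rule qunitary_paired_op[OF fin]) (use k enc[of "{}"] in \<open>auto simp: \<tau>0_def qbasis_def\<close>)
    then show ?thesis using True by (simp add: U_def)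
  next
    case False
    then have "(t - 1) div 3 < card I" using that by auto
    then have "e ((t - 1) div 3) \<in> I" by (rule ej)
    then show ?thesis
      using False fin qunitary_store_op[OF fin _ enc dec] qunitary_hadamard_query[OF fin]
      by (simp add: U_def)
  qed
  \<comment> \<open>The phase \<open>c\<close> gains a factor -1 for each true bit, because the
    third query is made while the query register holds \<open>Some i\<close>. Only its modulus
    enters the acceptance probability.\<close>
  have state: "\<exists>c. cmod c = 1 \<and> qstate I k U x (3 * j) = (\<lambda>b. c * qket (None, enc (red x j)) b)"
    if "j \<le> card I" for x j
    using that
  proof (induction j)
    case 0
    have "(None, 0) \<in> qbasis I k" using k by (simp add: qbasis_def)
    then have "qstate I k U x 0 = qket (None, enc {})"
      using qapply_paired_op_ket[OF fin, of "(None, 0)" k \<tau>0 "\<lambda>b. 0" "\<lambda>b. 1"]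
      by (simp add: U_def qinit_def qket_def \<tau>0_def)
    then show ?case by (intro exI[of _ 1]) (simp add: red_def)
  next
    case (Suc j)
    let ?i = "e j" let ?R = "red x j"
    have R: "?R \<subseteq> I" using Suc.prems ej by (auto simp: red_def)
    have iR: "?i \<notin> ?R"
    proof
      assume "?i \<in> ?R"
      then obtain j' where "j' < j" "e j = e j'" by (auto simp: red_def)
      then show False using inj_onD[OF bij_betw_imp_inj_on[OF e], of j j'] Suc.prems by simp
    qed
    have iI: "?i \<in> I" using ej Suc.prems by simp
    obtain c where c: "cmod c = 1" "qstate I k U x (3 * j) = (\<lambda>b. c * qket (None, enc ?R) b)"
      using Suc by auto
    have U1: "U (Suc (3 * j)) = hadamard_query ?i" and U2: "U (Suc (Suc (3 * j))) = hadamard_query ?i"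
    proof -
      have "Suc (3 * j) mod 3 = 1" "Suc (3 * j) div 3 = j" by presburger+
      then show "U (Suc (3 * j)) = hadamard_query ?i" "U (Suc (Suc (3 * j))) = hadamard_query ?i"
        by (simp_all add: U_def)
    qed
    have U3: "U (Suc (Suc (Suc (3 * j)))) = store_op enc dec ?i"
    proof -
      have "Suc (Suc (3 * j)) mod 3 = 2" "Suc (Suc (3 * j)) div 3 = j" by presburger+
      then show ?thesis by (simp add: U_def)
    qed
    have "qstate I k U x (Suc (Suc (3 * j))) = (\<lambda>b. c * qket (if x ?i then Some ?i else None, enc ?R) b)"
      using hadamard_query_twice[OF fin iI, of "enc ?R" k x] enc[OF R]
      by (simp add: U1 U2 c(2) qoracle_scale qapply_scale qoracle_ket)
    then have "qstate I k U x (Suc (Suc (Suc (3 * j))))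
       = (\<lambda>b. (c * (if x ?i then -1 else 1)) * qket (None, enc (red x (Suc j))) b)"
    proof -
      have red: "red x (Suc j) = (if x ?i then insert ?i ?R else ?R)"
        by (auto simp: red_def less_Suc_eq)
      show ?thesis
        using \<open>qstate I k U x (Suc (Suc (3 * j))) = _\<close> store_op_ket[OF fin iI R iR enc]
        by (cases "x ?i") (simp_all add: U3 red qoracle_scale qoracle_ket qapply_scale
            qapply_scale[of _ _ _ "-1", simplified])
    qed
    moreover have "cmod (c * (if x ?i then -1 else 1)) = 1" using c(1) by (simp add: norm_mult)
    moreover have eq: "3 * Suc j = Suc (Suc (Suc (3 * j)))" by simp
    ultimately show ?case unfolding eq by blast
  qed
  have "qaccept I k U S (3 * card I) x = (if f x then 1 else 0)" for x
  proof -
    have red: "red x (card I) = {i\<in>I. x i}"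
      using e by (auto simp: red_def bij_betw_def image_def)
    obtain c where c: "cmod c = 1"
      "qstate I k U x (3 * card I) = (\<lambda>b. c * qket (None, enc {i\<in>I. x i}) b)"
      using state[of "card I" x] red by auto
    have S_fin: "finite S"
    proof -
      have "S = (\<lambda>A. (None, enc A)) ` {A. A \<subseteq> I \<and> f (\<lambda>i. i \<in> A)}" by (auto simp: S_def)
      then show ?thesis using fin by simp
    qed
    have "f x = f (\<lambda>i. i \<in> {i\<in>I. x i})" by (rule dep) simp
    moreover have "(None, enc {i\<in>I. x i}) \<in> S \<longleftrightarrow> f (\<lambda>i. i \<in> {i\<in>I. x i})"
    proof
      assume "(None, enc {i\<in>I. x i}) \<in> S"
      then obtain A where "enc {i\<in>I. x i} = enc A" "A \<subseteq> I" "f (\<lambda>i. i \<in> A)" by (auto simp: S_def)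
      moreover from this have "A = {i\<in>I. x i}" using enc[of A] enc[of "{i\<in>I. x i}"] by auto
      ultimately show "f (\<lambda>i. i \<in> {i\<in>I. x i})" by simp
    next
      assume "f (\<lambda>i. i \<in> {i\<in>I. x i})"
      then show "(None, enc {i\<in>I. x i}) \<in> S" unfolding S_def by blast
    qed
    moreover have "qaccept I k U S (3 * card I) x = (\<Sum>b\<in>S. if b = (None, enc {i\<in>I. x i}) then 1 else 0)"
      unfolding qaccept_def c(2) by (intro sum.cong refl) (simp add: qket_def norm_mult c(1))
    ultimately show ?thesis using S_fin by simp
  qed
  moreover have "S \<subseteq> qbasis I k" using enc by (auto simp: S_def qbasis_def)
  ultimately show ?thesis
    unfolding qcomputes_def using k unit by (intro exI[of _ k] exI[of _ U] exI[of _ S]) auto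
qed

section \<open>Dominating sets\<close>

lemma finite_all_edges: "finite (all_edges n)"
proof -
  have "all_edges n \<subseteq> Pow {..<n}" by (auto simp: all_edges_def)
  then show ?thesis by (rule finite_subset) simp
qed

lemma card_all_edges_elem: "e \<in> all_edges n \<Longrightarrow> finite e \<and> card e = 2"
  by (auto simp: all_edges_def)

lemma f_subE:
  assumes "f_sub n H x"
  obtains \<phi> where "inj_on \<phi> {..<n}" "\<phi> ` {..<n} = {..<n}"
    "\<forall>u<n. \<forall>v<n. {u, v} \<in> H \<longrightarrow> x {\<phi> u, \<phi> v}"
  using assms unfolding f_sub_def by (metis endo_inj_surj finite_lessThan)

lemma f_sub_transfer:
  assumes "H \<subseteq> all_edges n" and \<pi>: "inj_on \<pi> {..<n}" "\<pi> ` {..<n} \<subseteq> {..<n}"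
    and edges: "\<And>u v. u < n \<Longrightarrow> v < n \<Longrightarrow> u \<noteq> v \<Longrightarrow> x {u, v} \<Longrightarrow> y {\<pi> u, \<pi> v}"
    and "f_sub n H x"
  shows "f_sub n H y"
proof -
  obtain \<phi> where \<phi>: "inj_on \<phi> {..<n}" "\<phi> ` {..<n} = {..<n}"
    and emb: "\<forall>u<n. \<forall>v<n. {u, v} \<in> H \<longrightarrow> x {\<phi> u, \<phi> v}"
    using assms(5) by (rule f_subE)
  have "y {(\<pi> \<circ> \<phi>) u, (\<pi> \<circ> \<phi>) v}" if uv: "u < n" "v < n" "{u, v} \<in> H" for u v
  proof -
    have "u \<noteq> v" using uv(3) assms(1) by (auto simp: all_edges_def doubleton_eq_iff)
    then have "\<phi> u \<noteq> \<phi> v" using inj_onD[OF \<phi>(1), of u v] uv by auto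
    moreover have "\<phi> u < n" "\<phi> v < n" using \<phi>(2) uv by auto
    ultimately show ?thesis using edges emb uv by simp
  qed
  moreover have "inj_on (\<pi> \<circ> \<phi>) {..<n}" using \<phi> \<pi>(1) by (simp add: comp_inj_on)
  moreover have "(\<pi> \<circ> \<phi>) ` {..<n} \<subseteq> {..<n}" using \<phi>(2) \<pi>(2) by (metis image_comp)
  ultimately show ?thesis unfolding f_sub_def by (intro exI[of _ "\<pi> \<circ> \<phi>"]) simp
qed

lemma f_sub_mono:
  assumes "H \<subseteq> all_edges n" "\<And>u v. u < n \<Longrightarrow> v < n \<Longrightarrow> u \<noteq> v \<Longrightarrow> x {u, v} \<Longrightarrow> y {u, v}" "f_sub n H x"
  shows "f_sub n H y"
  using f_sub_transfer[OF assms(1), of id x y] assms(2,3) by simp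

text \<open>A \<open>LEAST\<close> has the required property only if some number has it. The
  exhaustive algorithm supplies one, since \<open>f_sub n H\<close> reads no bit outside
  \<open>all_edges n\<close>.\<close>

lemma qcomputes_Qcomplexity:
  assumes "H \<subseteq> all_edges n"
  shows "qcomputes (all_edges n) (f_sub n H) (Qcomplexity (all_edges n) (f_sub n H))"
  unfolding Qcomplexity_def
proof (rule LeastI)
  show "qcomputes (all_edges n) (f_sub n H) (3 * card (all_edges n))"
  proof (rule qcomputes_exhaustive[OF finite_all_edges])
    fix x y :: "nat set \<Rightarrow> bool" assume eq: "\<And>i. i \<in> all_edges n \<Longrightarrow> x i = y i"
    have "x {u, v} = y {u, v}" if "u < n" "v < n" "u \<noteq> v" for u v
      using eq[of "{u, v}"] that by (auto simp: all_edges_def)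
    then show "f_sub n H x = f_sub n H y"
      using f_sub_mono[OF assms, of x y] f_sub_mono[OF assms, of y x] by blast
  qed
qed

section \<open>A maximum independent set and the complementary vertex cover\<close>

locale max_indep_set =
  fixes n :: nat and H :: "nat set set" and A :: "nat set"
  assumes H_edges: "H \<subseteq> all_edges n" and H_nonempty: "H \<noteq> {}"
    and A_sub: "A \<subseteq> {..<n}" and A_indep: "\<And>u v. u \<in> A \<Longrightarrow> v \<in> A \<Longrightarrow> {u, v} \<notin> H"
    and A_max: "\<And>S. S \<subseteq> {..<n} \<Longrightarrow> (\<And>u v. u \<in> S \<Longrightarrow> v \<in> S \<Longrightarrow> {u, v} \<notin> H) \<Longrightarrow> card S \<le> card A"
begin

definition C :: "nat set" where "C = {..<n} - A"
definition \<alpha> :: nat where "\<alpha> = card A"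
definition r :: nat where "r = card C"
definition nbA :: "nat \<Rightarrow> nat set" where "nbA v = {a \<in> A. {v, a} \<in> H}"
definition d :: nat where "d = Min ((\<lambda>v. card (nbA v)) ` C)"

lemma finite_A [simp]: "finite A" and finite_C [simp]: "finite C"
  using A_sub finite_subset by (auto simp: C_def)

lemma edge_neq: "{u, v} \<in> H \<Longrightarrow> u \<noteq> v \<and> u < n \<and> v < n"
  using H_edges by (fastforce simp: all_edges_def doubleton_eq_iff)

lemma n_eq: "n = \<alpha> + r"
proof -
  have "card C = n - card A" unfolding C_def using A_sub by (simp add: card_Diff_subset)
  moreover have "card A \<le> n" using card_mono[OF _ A_sub] by simp
  ultimately show ?thesis by (simp add: \<alpha>_def r_def)
qed

lemma C_nonempty: "C \<noteq> {}"
proof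
  assume "C = {}"
  obtain u v where "{u, v} \<in> H" using H_nonempty H_edges by (fastforce simp: all_edges_def)
  then show False using edge_neq[of u v] A_indep[of u v] \<open>C = {}\<close> by (auto simp: C_def)
qed

lemma r_pos: "r > 0"
  using C_nonempty by (simp add: r_def card_gt_0_iff)

lemma nbA_sub: "nbA v \<subseteq> A"
  by (auto simp: nbA_def)

lemma finite_nbA [simp]: "finite (nbA v)"
  using nbA_sub finite_A by (rule finite_subset)

lemma d_le: "v \<in> C \<Longrightarrow> d \<le> card (nbA v)"
  unfolding d_def by (intro Min_le) auto

lemma d_attained: "\<exists>c\<in>C. card (nbA c) = d"
  unfolding d_def using Min_in[of "(\<lambda>v. card (nbA v)) ` C"] C_nonempty by fastforce

lemma d_le_\<alpha>: "d \<le> \<alpha>"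
  using d_attained card_mono[OF finite_A nbA_sub] by (metis \<alpha>_def)

text \<open>Choose \<open>c\<close> in \<open>C\<close> with only \<open>d\<close> neighbours in
  \<open>A\<close>. Send the rest of \<open>C\<close> onto the dominating set \<open>T\<close>,
  \<open>c\<close> to \<open>v0\<close>, its neighbours in \<open>A\<close> into \<open>D\<close>,
  and the remaining vertices anywhere. Every edge of \<open>H\<close> meets \<open>C\<close>, so it
  either has an end mapped into \<open>T\<close> or joins \<open>c\<close> to
  \<open>nbA c\<close>.\<close>

lemma f_sub_star:
  assumes T: "T \<subseteq> {..<n}" "card T = r - 1"
    and dom: "\<And>t v. t \<in> T \<Longrightarrow> v < n \<Longrightarrow> v \<noteq> t \<Longrightarrow> x {t, v}"
    and v0: "v0 < n" "v0 \<notin> T"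
    and D: "D \<subseteq> {..<n} - T - {v0}" "card D \<ge> d" "\<And>u. u \<in> D \<Longrightarrow> x {v0, u}"
  shows "f_sub n H x"
proof -
  obtain c where c: "c \<in> C" "card (nbA c) = d" using d_attained by blast
  obtain D' where D': "D' \<subseteq> D" "card D' = d" "finite D'" using D(2) obtain_subset_with_card_n by metis
  let ?E = "{..<n} - T - {v0} - D'"
  have finT: "finite T" using T(1) finite_subset by blast
  have "card (C - {c}) = card T" using c(1) T(2) by (simp add: r_def)
  then obtain f1 where f1: "bij_betw f1 (C - {c}) T"
    using finite_same_card_bij[of "C - {c}" T] finT by auto
  obtain f2 where f2: "bij_betw f2 (nbA c) D'"
    using finite_same_card_bij[of "nbA c" D'] c D' by auto
  \<comment> \<open>This is \<open>\<alpha> - d\<close>, the number of vertices of \<open>A\<close>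
    that are not neighbours of \<open>c\<close>.\<close>
  have "card ?E = n - (r - 1) - 1 - d"
  proof -
    have "card ({..<n} - T) = n - (r - 1)" using T finT by (simp add: card_Diff_subset)
    then have "card ({..<n} - T - {v0}) = n - (r - 1) - 1" using v0 by simp
    then show ?thesis using D(1) D' by (subst card_Diff_subset) auto
  qed
  moreover have "card (A - nbA c) = \<alpha> - d"
    using card_Diff_subset[OF finite_nbA nbA_sub] c(2) by (simp add: \<alpha>_def)
  ultimately have "card (A - nbA c) = card ?E" using n_eq r_pos by simp
  then obtain f3 where f3: "bij_betw f3 (A - nbA c) ?E"
    using finite_same_card_bij[of "A - nbA c" ?E] by auto
  define \<phi> where "\<phi> v = (if v \<in> C - {c} then f1 v else if v = c then v0
     else if v \<in> nbA c then f2 v else f3 v)" for v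
  have cA: "c \<notin> A" "C \<inter> A = {}" using c(1) by (auto simp: C_def)
  have b1: "bij_betw \<phi> (C - {c}) T"
    using f1 by (rule bij_betw_cong[THEN iffD1, rotated]) (simp add: \<phi>_def)
  have b0: "bij_betw \<phi> {c} {v0}" by (simp add: \<phi>_def)
  have b2: "bij_betw \<phi> (nbA c) D'"
    using f2 by (rule bij_betw_cong[THEN iffD1, rotated]) (use cA nbA_sub[of c] in \<open>auto simp: \<phi>_def\<close>)
  have b3: "bij_betw \<phi> (A - nbA c) ?E"
    using f3 by (rule bij_betw_cong[THEN iffD1, rotated]) (use cA in \<open>auto simp: \<phi>_def\<close>)
  have "bij_betw \<phi> (((C - {c}) \<union> {c}) \<union> (nbA c \<union> (A - nbA c))) ((T \<union> {v0}) \<union> (D' \<union> ?E))"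
    using b0 b1 b2 b3 v0 D(1) D'(1) by (intro bij_betw_combine) auto
  moreover have "((C - {c}) \<union> {c}) \<union> (nbA c \<union> (A - nbA c)) = {..<n}"
    using c(1) A_sub nbA_sub[of c] by (auto simp: C_def)
  moreover have "(T \<union> {v0}) \<union> (D' \<union> ?E) = {..<n}"
    using T v0 D(1) D'(1) by auto
  ultimately have bij: "bij_betw \<phi> {..<n} {..<n}" by simp
  have main: "x {\<phi> u, \<phi> v}" if uv: "{u, v} \<in> H" "u \<in> C" for u v
  proof (cases "u = c")
    case False
    then have "\<phi> u \<in> T" using b1 uv(2) by (auto simp: bij_betw_def)
    moreover have "\<phi> v \<noteq> \<phi> u" "\<phi> v < n"
      using edge_neq[OF uv(1)] bij by (auto simp: bij_betw_def inj_on_def)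
    ultimately show ?thesis using dom by blast
  next
    case True
    show ?thesis
    proof (cases "v \<in> A")
      case vA: True
      then have "v \<in> nbA c" using uv True by (simp add: nbA_def)
      then have "\<phi> v \<in> D'" using b2 by (auto simp: bij_betw_def)
      moreover have "\<phi> u = v0" using True by (simp add: \<phi>_def)
      ultimately show ?thesis using D(3) D'(1) by auto
    next
      case False
      then have "v \<in> C - {c}" using edge_neq[OF uv(1)] True by (auto simp: C_def)
      then have "\<phi> v \<in> T" using b1 by (auto simp: bij_betw_def)
      moreover have "\<phi> u \<noteq> \<phi> v" "\<phi> u < n"
        using edge_neq[OF uv(1)] bij by (auto simp: bij_betw_def inj_on_def)
      ultimately show ?thesis using dom[of "\<phi> v" "\<phi> u"] by (simp add: insert_commute)
    qed
  qed
  have "x {\<phi> u, \<phi> v}" if uv: "{u, v} \<in> H" for u v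
  proof (cases "u \<in> C")
    case True
    then show ?thesis using main uv by blast
  next
    case False
    then have "v \<in> C" using A_indep[of u v] uv edge_neq[OF uv] by (auto simp: C_def)
    then show ?thesis using main[of v u] uv by (simp add: insert_commute)
  qed
  then show ?thesis unfolding f_sub_def using bij
    by (intro exI[of _ \<phi>]) (auto simp: bij_betw_def)
qed

text \<open>An embedding permutes the vertices, so the preimage of \<open>S\<close> would be an
  independent set of \<open>H\<close> larger than the maximum.\<close>

lemma not_f_sub_indep:
  assumes S: "S \<subseteq> {..<n}" "card S > \<alpha>" and x: "\<And>u v. u \<in> S \<Longrightarrow> v \<in> S \<Longrightarrow> \<not> x {u, v}"
  shows "\<not> f_sub n H x"
proof
  assume "f_sub n H x"
  then obtain \<phi> where \<phi>: "inj_on \<phi> {..<n}" and surj: "\<phi> ` {..<n} = {..<n}"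
    and emb: "\<forall>u<n. \<forall>v<n. {u, v} \<in> H \<longrightarrow> x {\<phi> u, \<phi> v}"
    by (rule f_subE)
  let ?W = "{u\<in>{..<n}. \<phi> u \<in> S}"
  have "S \<subseteq> \<phi> ` {..<n}" using S(1) unfolding surj .
  then have "card S = card (\<phi> ` ?W)" by (intro arg_cong[of _ _ card]) auto
  also have "\<dots> = card ?W" by (intro card_image inj_on_subset[OF \<phi>]) auto
  also have "\<dots> \<le> \<alpha>" unfolding \<alpha>_def
  proof (rule A_max)
    fix u v assume "u \<in> ?W" "v \<in> ?W"
    then show "{u, v} \<notin> H" using x[of "\<phi> u" "\<phi> v"] emb by auto
  qed auto
  finally show False using S(2) by simp
qed

text \<open>Inputs consist of all edges meeting a set of \<open>r\<close> vertices, or of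
  \<open>r - 1\<close> vertices, which leaves \<open>\<alpha> + 1\<close> independent ones; the
  relation is inclusion. The degrees of the relation are \<open>r\<close> and
  \<open>\<alpha> + 1\<close>.\<close>

lemma dominating_sets_bound:
  assumes comp: "qcomputes (all_edges n) (f_sub n H) Tq"
  shows "sqrt (real r * real (\<alpha> + 1) / 2) \<le> 36 * real Tq"
proof -
  let ?P = "{T. T \<subseteq> {..<n} \<and> card T = r}" and ?Q = "{T. T \<subseteq> {..<n} \<and> card T = r - 1}"
  have finsub: "finite T" if "T \<subseteq> {..<n}" for T using that finite_subset by blast
  have "sqrt (real r * real (\<alpha> + 1) / (1 * 2)) \<le> 36 * real Tq"
  proof (rule adversary_bound[where P = ?P and Q = ?Q and X = "\<lambda>T e. e \<inter> T \<noteq> {}"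
        and Y = "\<lambda>T e. e \<inter> T \<noteq> {}" and R = "\<lambda>p q. q \<subseteq> p", OF finite_all_edges _ _ comp])
    fix p assume p: "p \<in> ?P"
    then obtain v0 where v0: "v0 \<in> p" using r_pos by fastforce
    show "f_sub n H (\<lambda>e. e \<inter> p \<noteq> {})"
    proof (rule f_sub_star[of "p - {v0}" _ v0 "{..<n} - p"])
      show "d \<le> card ({..<n} - p)"
        using p finsub[of p] d_le_\<alpha> n_eq by (auto simp: card_Diff_subset)
    qed (use p v0 finsub[of p] in auto)
    have "r = card p" using p by simp
    also have "\<dots> = card ((\<lambda>v. p - {v}) ` p)" by (intro card_image[symmetric]) (auto simp: inj_on_def)
    also have "\<dots> \<le> card {q\<in>?Q. q \<subseteq> p}"
      using p finsub[of p] by (intro card_mono) auto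
    finally show "real r \<le> real (card {q\<in>?Q. q \<subseteq> p})" by simp
    fix e
    \<comment> \<open>The removed vertex lies on \<open>e\<close> and no vertex of \<open>q\<close>
      does, so \<open>q\<close> must be \<open>p - e\<close>.\<close>
    have "{q\<in>?Q. q \<subseteq> p \<and> (e \<inter> p \<noteq> {}) \<noteq> (e \<inter> q \<noteq> {})} \<subseteq> {p - e}"
    proof
      fix q assume "q \<in> {q\<in>?Q. q \<subseteq> p \<and> (e \<inter> p \<noteq> {}) \<noteq> (e \<inter> q \<noteq> {})}"
      then have q: "q \<subseteq> p" "e \<inter> p \<noteq> {}" "e \<inter> q = {}" "card q = r - 1" by auto
      have "card (p - q) = 1" using q p r_pos card_Diff_subset[of q p] finite_subset[of q p] finsub[of p] by simp
      then obtain u where "p - q = {u}" by (rule card_1_singletonE)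
      then have pu: "p = insert u q" using q(1) by auto
      then have "u \<in> e" using q(2,3) by auto
      then show "q \<in> {p - e}" using pu q(3) \<open>p - q = {u}\<close> by auto
    qed
    then have "card {q\<in>?Q. q \<subseteq> p \<and> (e \<inter> p \<noteq> {}) \<noteq> (e \<inter> q \<noteq> {})} \<le> card {p - e}"
      by (intro card_mono) auto
    then show "real (card {q\<in>?Q. q \<subseteq> p \<and> (e \<inter> p \<noteq> {}) \<noteq> (e \<inter> q \<noteq> {})}) \<le> 1" by simp
  next
    fix q assume q: "q \<in> ?Q"
    then have card_co: "card ({..<n} - q) = \<alpha> + 1"
      using finsub[of q] n_eq r_pos by (auto simp: card_Diff_subset)
    show "\<not> f_sub n H (\<lambda>e. e \<inter> q \<noteq> {})"
      using card_co by (intro not_f_sub_indep[of "{..<n} - q"]) auto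
    have "\<alpha> + 1 = card ((\<lambda>v. insert v q) ` ({..<n} - q))"
      unfolding card_co[symmetric] by (intro card_image[symmetric]) (auto simp: inj_on_def)
    also have "\<dots> \<le> card {p\<in>?P. q \<subseteq> p}"
      using q finsub[of q] r_pos by (intro card_mono) auto
    finally show "real (\<alpha> + 1) \<le> real (card {p\<in>?P. q \<subseteq> p})" by simp
    fix e assume e: "e \<in> all_edges n"
    \<comment> \<open>Seen from \<open>q\<close>, the added vertex may be either end of
      \<open>e\<close>; this is the factor 2.\<close>
    have "{p\<in>?P. q \<subseteq> p \<and> (e \<inter> p \<noteq> {}) \<noteq> (e \<inter> q \<noteq> {})} \<subseteq> (\<lambda>u. insert u q) ` e"
    proof
      fix p assume "p \<in> {p\<in>?P. q \<subseteq> p \<and> (e \<inter> p \<noteq> {}) \<noteq> (e \<inter> q \<noteq> {})}"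
      then have p: "q \<subseteq> p" "e \<inter> p \<noteq> {}" "e \<inter> q = {}" "card p = r" "p \<subseteq> {..<n}" by auto
      have "card (p - q) = 1" using q p r_pos card_Diff_subset[of q p] finite_subset[of q p] finsub[of p] by simp
      then obtain u where "p - q = {u}" by (rule card_1_singletonE)
      then have pu: "p = insert u q" using p(1) by auto
      then have "u \<in> e" using p(2,3) by auto
      with pu have "u \<in> e" "p = insert u q" by simp_all
      then show "p \<in> (\<lambda>u. insert u q) ` e" by blast
    qed
    then have "card {p\<in>?P. q \<subseteq> p \<and> (e \<inter> p \<noteq> {}) \<noteq> (e \<inter> q \<noteq> {})} \<le> card ((\<lambda>u. insert u q) ` e)"
      using card_all_edges_elem[OF e] by (intro card_mono) auto
    also have "\<dots> \<le> 2" using card_image_le[of e "\<lambda>u. insert u q"] card_all_edges_elem[OF e] by simp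
    finally show "real (card {p\<in>?P. q \<subseteq> p \<and> (e \<inter> p \<noteq> {}) \<noteq> (e \<inter> q \<noteq> {})}) \<le> 2" by simp
  next
    show "?P \<noteq> {}" using n_eq by (auto intro!: exI[of _ "{..<r}"])
  qed (use r_pos in auto)
  then show ?thesis by simp
qed

end

section \<open>Cliques with few missing edges\<close>

context max_indep_set
begin

text \<open>The clique is \<open>{..<l}\<close>, the independent set is \<open>{l..\<alpha>}\<close>, and \<open>Z\<close> is the set of missing edges
  between them; the vertices above \<open>\<alpha>\<close> are joined to everything.\<close>
definition split_input :: "nat \<Rightarrow> (nat \<times> nat) set \<Rightarrow> nat set \<Rightarrow> bool" where
  "split_input l Z e \<longleftrightarrow>
     \<not> ((\<exists>u v. l \<le> u \<and> u \<le> \<alpha> \<and> l \<le> v \<and> v \<le> \<alpha> \<and> e = {u, v}) \<or> (\<exists>u v. (u, v) \<in> Z \<and> e = {u, v}))"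

lemma split_input_pair:
  assumes "Z \<subseteq> {..<l} \<times> {l..\<alpha>}"
  shows "split_input l Z {u, v} \<longleftrightarrow>
    \<not> (l \<le> u \<and> u \<le> \<alpha> \<and> l \<le> v \<and> v \<le> \<alpha>) \<and> (u, v) \<notin> Z \<and> (v, u) \<notin> Z"
  unfolding split_input_def by (auto simp: doubleton_eq_iff)

text \<open>The set \<open>W\<close> of vertices placed on \<open>{..\<alpha>}\<close> has one
  vertex more than \<open>A\<close>. So it meets \<open>C\<close>, in \<open>t\<close> vertices say,
  and misses only \<open>t - 1\<close> vertices of \<open>A\<close>. A vertex of
  \<open>W \<inter> C\<close> must land on the clique, where its missing row leaves too few places
  for its neighbours.\<close>

lemma split_input_zero:
  assumes l: "l + r \<le> d" and Z: "Z \<subseteq> {..<l} \<times> {l..\<alpha>}"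
    and rows: "\<And>u. u < l \<Longrightarrow> card (Z `` {u}) = \<alpha> + 1 - d"
  shows "\<not> f_sub n H (split_input l Z)"
proof
  assume "f_sub n H (split_input l Z)"
  then obtain \<phi> where inj: "inj_on \<phi> {..<n}" and surj: "\<phi> ` {..<n} = {..<n}"
    and emb: "\<forall>u<n. \<forall>v<n. {u, v} \<in> H \<longrightarrow> split_input l Z {\<phi> u, \<phi> v}"
    by (rule f_subE)
  define pre where "pre S = {u\<in>{..<n}. \<phi> u \<in> S}" for S
  have card_pre: "card (pre S) = card S" if "S \<subseteq> {..<n}" for S
  proof -
    have "S \<subseteq> \<phi> ` {..<n}" using that unfolding surj .
    then have "S = \<phi> ` pre S" by (auto simp: pre_def)
    moreover have "inj_on \<phi> (pre S)" by (rule inj_on_subset[OF inj]) (auto simp: pre_def)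
    ultimately show ?thesis by (metis card_image)
  qed
  have fin_pre: "finite (pre S)" for S by (simp add: pre_def)
  have n: "\<alpha> < n" using n_eq r_pos by simp
  define W where "W = pre {..\<alpha>}"
  have card_W: "card W = \<alpha> + 1" unfolding W_def by (subst card_pre) (use n in auto)
  have finW: "finite W" using fin_pre W_def by simp
  have W_sub: "W \<subseteq> A \<union> C" using A_sub by (auto simp: W_def pre_def C_def)
  define t where "t = card (W \<inter> C)"
  have "W = (W \<inter> A) \<union> (W \<inter> C)" using W_sub by auto
  then have card_WA: "card (W \<inter> A) + t = \<alpha> + 1"
    unfolding t_def card_W[symmetric]
    by (subst card_Un_disjoint[symmetric]) (use finW in \<open>auto simp: C_def\<close>)
  have t_le: "t \<le> r" unfolding t_def r_def by (intro card_mono) auto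
  have "card (W \<inter> A) \<le> \<alpha>" unfolding \<alpha>_def by (intro card_mono) auto
  then have t_pos: "t \<ge> 1" using card_WA by simp
  have card_AW: "card (A - W) + 1 = t"
  proof -
    have "card (A - W) + card (W \<inter> A) = \<alpha>" unfolding \<alpha>_def
      by (subst card_Un_disjoint[symmetric]) (auto intro!: arg_cong[of _ _ card])
    then show ?thesis using card_WA by simp
  qed
  have nb: "d + 1 \<le> card (nbA u \<inter> W) + t" if "u \<in> C" for u
  proof -
    have "d \<le> card (nbA u)" using that by (rule d_le)
    also have "\<dots> \<le> card ((nbA u \<inter> W) \<union> (A - W))"
      using nbA_sub[of u] by (intro card_mono) auto
    also have "\<dots> \<le> card (nbA u \<inter> W) + card (A - W)" by (rule card_Un_le)
    finally show ?thesis using card_AW by simp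
  qed
  have nbA_lt: "a < n" if "a \<in> nbA u" for a u using that nbA_sub A_sub by blast
  \<comment> \<open>On the independent part, \<open>u\<close> could place its more than
    \<open>d - t\<close> neighbours in \<open>W\<close> only on the \<open>l\<close> clique
    vertices, but \<open>l + t \<le> l + r \<le> d\<close>.\<close>
  have to_L: "\<phi> u < l" if u: "u \<in> W \<inter> C" for u
  proof (rule ccontr)
    assume "\<not> \<phi> u < l"
    have "\<phi> ` (nbA u \<inter> W) \<subseteq> {..<l}"
    proof
      fix y assume "y \<in> \<phi> ` (nbA u \<inter> W)"
      then obtain a where a: "a \<in> nbA u" "a \<in> W" "y = \<phi> a" by blast
      have "{u, a} \<in> H" using a(1) by (simp add: nbA_def)
      then have "split_input l Z {\<phi> u, \<phi> a}" using emb edge_neq[of u a] by blast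
      moreover have "\<phi> u \<le> \<alpha>" "\<phi> a \<le> \<alpha>" using u a by (auto simp: W_def pre_def)
      ultimately show "y \<in> {..<l}"
        using \<open>\<not> \<phi> u < l\<close> a(3) unfolding split_input_pair[OF Z] by auto
    qed
    then have "card (\<phi> ` (nbA u \<inter> W)) \<le> card {..<l}" by (intro card_mono) auto
    moreover have "card (\<phi> ` (nbA u \<inter> W)) = card (nbA u \<inter> W)"
      by (intro card_image inj_on_subset[OF inj]) (use nbA_lt in auto)
    ultimately show False using nb[of u] u t_le l by auto
  qed
  have "W \<inter> C \<noteq> {}" using t_pos unfolding t_def by (metis card.empty not_one_le_zero)
  then obtain u where u: "u \<in> W \<inter> C" by blast
  \<comment> \<open>The vertices placed on the row missing at \<open>\<phi> u\<close> are in the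
    independent part, hence in \<open>A\<close> by \<open>to_L\<close>, and are not neighbours of
    \<open>u\<close>. So \<open>u\<close> has at most (\<alpha> + 1 - t) - (\<alpha> + 1 - d) = d -
    t neighbours in \<open>W \<inter> A\<close>, one fewer than \<open>nb\<close> demands.\<close>
  define V where "V = pre (Z `` {\<phi> u})"
  have Zrow: "Z `` {\<phi> u} \<subseteq> {l..\<alpha>}" using Z by auto
  have card_V: "card V = \<alpha> + 1 - d"
    unfolding V_def using rows[OF to_L[OF u]] Zrow n by (subst card_pre) auto
  have "V \<subseteq> W" using Zrow by (auto simp: V_def W_def pre_def)
  moreover have "V \<inter> C = {}"
  proof (rule ccontr)
    assume "V \<inter> C \<noteq> {}"
    then obtain v where v: "v \<in> V" "v \<in> W \<inter> C" using \<open>V \<subseteq> W\<close> by auto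
    then show False using to_L[OF v(2)] Zrow by (auto simp: V_def pre_def)
  qed
  ultimately have V_A: "V \<subseteq> W \<inter> A" using W_sub by blast
  have disj: "nbA u \<inter> W \<inter> V = {}"
  proof (rule ccontr)
    assume "nbA u \<inter> W \<inter> V \<noteq> {}"
    then obtain a where a: "a \<in> nbA u" "a \<in> V" by auto
    have "{u, a} \<in> H" using a(1) by (simp add: nbA_def)
    then have "split_input l Z {\<phi> u, \<phi> a}" using emb edge_neq[of u a] by blast
    then show False using a(2) unfolding split_input_pair[OF Z] by (auto simp: V_def pre_def)
  qed
  have "card (nbA u \<inter> W) + card V = card ((nbA u \<inter> W) \<union> V)"
    using disj finW V_A by (intro card_Un_disjoint[symmetric]) (auto simp: V_def fin_pre)
  also have "\<dots> \<le> card (W \<inter> A)"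
    using V_A nbA_sub[of u] finW by (intro card_mono) auto
  finally show False using nb[of u] u card_V card_WA d_le_\<alpha> by auto
qed

text \<open>The short row leaves \<open>u\<close> at least \<open>d\<close> neighbours among the
  other \<alpha> vertices of \<open>{..\<alpha>}\<close>, and the \<open>r - 1\<close> vertices
  above \<alpha> are dominating, so \<open>f_sub_star\<close> applies.\<close>

lemma split_input_one:
  assumes l: "l \<le> \<alpha>" and Z: "Z \<subseteq> {..<l} \<times> {l..\<alpha>}" and u: "u < l" "card (Z `` {u}) \<le> \<alpha> - d"
  shows "f_sub n H (split_input l Z)"
proof -
  have n: "\<alpha> < n" using n_eq r_pos by simp
  let ?D = "{..\<alpha>} - {u} - Z `` {u}"
  have row: "Z `` {u} \<subseteq> {..\<alpha>} - {u}" using Z u by auto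
  have "card ?D = \<alpha> - card (Z `` {u})"
    using u l row by (subst card_Diff_subset) (auto intro: finite_subset[OF row])
  then have "d \<le> card ?D" using u(2) d_le_\<alpha> by simp
  moreover have "split_input l Z {t, v}" if "t \<in> {\<alpha><..<n}" "v < n" "v \<noteq> t" for t v
    using that Z u l unfolding split_input_pair[OF Z] by auto
  moreover have "split_input l Z {u, v}" if "v \<in> ?D" for v
    using that Z u unfolding split_input_pair[OF Z] by auto
  ultimately show ?thesis
    using u l n n_eq r_pos by (intro f_sub_star[of "{\<alpha><..<n}" _ u ?D]) auto
qed

text \<open>As \<open>u < l \<le> v\<close>, the edge determines the ordered pair. Hence a query
  separates an input from at most one related input.\<close>

lemma split_input_insert_diff:
  assumes "Z \<subseteq> {..<l} \<times> {l..\<alpha>}" "(u, v) \<in> {..<l} \<times> {l..\<alpha>}"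
    and "split_input l Z e \<noteq> split_input l (insert (u, v) Z) e"
  shows "(u, v) = (Min e, Max e)"
proof -
  have "e = {u, v}" using assms(3) by (auto simp: split_input_def)
  then show ?thesis using assms(2) by auto
qed

text \<open>In \<open>?Q\<close> all rows have \<open>z + 1\<close> missing edges; in
  \<open>?P\<close> exactly one row has one fewer. The short row has \<open>d + 1 - l\<close> places
  for a further missing edge, and conversely any of \<open>l * (z + 1)\<close> missing edges can be
  restored. The factor \<open>z + 1\<close> is dropped at the end.\<close>

lemma split_input_bound:
  assumes comp: "qcomputes (all_edges n) (f_sub n H) Tq" and l: "l \<ge> 1" "l + r \<le> d"
  shows "sqrt (real l * real (d + 1 - l)) \<le> 36 * real Tq"
proof -
  define z where "z = \<alpha> - d"
  let ?B = "{..<l} \<times> {l..\<alpha>}"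
  let ?Q = "{Z. Z \<subseteq> ?B \<and> (\<forall>u<l. card (Z `` {u}) = z + 1)}"
  let ?P = "{Z. Z \<subseteq> ?B \<and> (\<exists>u<l. card (Z `` {u}) = z \<and> (\<forall>u'<l. u' \<noteq> u \<longrightarrow> card (Z `` {u'}) = z + 1))}"
  let ?R = "\<lambda>p q. \<exists>e. e \<notin> p \<and> q = insert e p"
  have l\<alpha>: "l \<le> \<alpha>" using l(2) d_le_\<alpha> by simp
  have row_sub: "Z `` {u} \<subseteq> {l..\<alpha>}" if "Z \<subseteq> ?B" for Z u using that by auto
  have fin_row: "finite (Z `` {u})" if "Z \<subseteq> ?B" for Z u
    using row_sub[OF that] finite_subset by blast
  have row_insert: "insert (u, v) Z `` {w} = (if w = u then insert v (Z `` {u}) else Z `` {w})" for u v w Z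
    by auto
  have remove: "q - {(u, v)} \<in> ?P" if q: "q \<in> ?Q" "(u, v) \<in> q" for q u v
  proof -
    have "(q - {(u, v)}) `` {w} = (if w = u then q `` {u} - {v} else q `` {w})" for w by auto
    moreover have "u < l" "v \<in> q `` {u}" using q by auto
    ultimately show ?thesis using q by auto
  qed
  have card_q: "card q = l * (z + 1)" if q: "q \<in> ?Q" for q
  proof -
    have "q = Sigma {..<l} (\<lambda>u. q `` {u})" using q by auto
    then have "card q = card (Sigma {..<l} (\<lambda>u. q `` {u}))" by simp
    also have "\<dots> = (\<Sum>u\<in>{..<l}. card (q `` {u}))"
      using q fin_row by (intro card_SigmaI) auto
    also have "\<dots> = l * (z + 1)" using q by simp
    finally show ?thesis .
  qed
  have diff_p: "q = insert (Min e, Max e) p" and diff_q: "p = q - {(Min e, Max e)}"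
    if pq: "p \<in> ?P" "q \<in> ?Q" "?R p q" "split_input l p e \<noteq> split_input l q e" for p q e
  proof -
    obtain u v where uv: "(u, v) \<notin> p" "q = insert (u, v) p" using pq(3) by auto
    have "(u, v) = (Min e, Max e)"
      using pq uv by (intro split_input_insert_diff[of p l]) auto
    then show "q = insert (Min e, Max e) p" "p = q - {(Min e, Max e)}" using uv by auto
  qed
  have "sqrt (real (d + 1 - l) * real (l * (z + 1)) / (1 * 1)) \<le> 36 * real Tq"
  proof (rule adversary_bound[where P = ?P and Q = ?Q and X = "split_input l" and Y = "split_input l"
        and R = ?R, OF finite_all_edges _ _ comp])
    show "finite ?P" "finite ?Q" by (rule finite_subset[of _ "Pow ?B"]; auto)+
    fix p assume p: "p \<in> ?P"
    then obtain u where u: "u < l" "card (p `` {u}) = z"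
      "\<And>u'. u' < l \<Longrightarrow> u' \<noteq> u \<Longrightarrow> card (p `` {u'}) = z + 1" by blast
    show "f_sub n H (split_input l p)"
      using p u l\<alpha> by (intro split_input_one[of l p u]) (auto simp: z_def)
    have pB: "p \<subseteq> ?B" using p by simp
    have "d + 1 - l = card ({l..\<alpha>} - p `` {u})"
      using fin_row[OF pB] row_sub[OF pB] u(2) l(2) d_le_\<alpha>
      by (subst card_Diff_subset) (auto simp: z_def)
    also have "\<dots> = card ((\<lambda>v. insert (u, v) p) ` ({l..\<alpha>} - p `` {u}))"
      by (intro card_image[symmetric]) (auto simp: inj_on_def)
    also have "\<dots> \<le> card {q\<in>?Q. ?R p q}"
    proof (rule card_mono)
      show "finite {q\<in>?Q. ?R p q}" by (rule finite_subset[of _ "Pow ?B"]) auto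
      show "(\<lambda>v. insert (u, v) p) ` ({l..\<alpha>} - p `` {u}) \<subseteq> {q\<in>?Q. ?R p q}"
      proof
        fix q assume "q \<in> (\<lambda>v. insert (u, v) p) ` ({l..\<alpha>} - p `` {u})"
        then obtain v where v: "v \<in> {l..\<alpha>}" "v \<notin> p `` {u}" "q = insert (u, v) p" by blast
        have "card (q `` {w}) = z + 1" if "w < l" for w
          unfolding v(3) row_insert using v(2) u that fin_row[OF pB] by simp
        moreover have "q \<subseteq> ?B" using pB v u(1) by auto
        moreover have "?R p q" using v by auto
        ultimately show "q \<in> {q\<in>?Q. ?R p q}" by simp
      qed
    qed
    finally show "real (d + 1 - l) \<le> real (card {q\<in>?Q. ?R p q})" by simp
    fix e
    have "{q\<in>?Q. ?R p q \<and> split_input l p e \<noteq> split_input l q e} \<subseteq> {insert (Min e, Max e) p}"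
      using diff_p[OF p] by blast
    then have "card {q\<in>?Q. ?R p q \<and> split_input l p e \<noteq> split_input l q e} \<le> card {insert (Min e, Max e) p}"
      by (intro card_mono) auto
    then show "real (card {q\<in>?Q. ?R p q \<and> split_input l p e \<noteq> split_input l q e}) \<le> 1" by simp
  next
    fix q assume q: "q \<in> ?Q"
    show "\<not> f_sub n H (split_input l q)"
      using q l d_le_\<alpha> by (intro split_input_zero) (auto simp: z_def)
    have "l * (z + 1) = card ((\<lambda>e. q - {e}) ` q)"
      unfolding card_q[OF q, symmetric] by (intro card_image[symmetric]) (auto simp: inj_on_def)
    also have "\<dots> \<le> card {p\<in>?P. ?R p q}"
    proof (rule card_mono)
      show "finite {p\<in>?P. ?R p q}" by (rule finite_subset[of _ "Pow ?B"]) auto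
      show "(\<lambda>e. q - {e}) ` q \<subseteq> {p\<in>?P. ?R p q}"
      proof
        fix p assume "p \<in> (\<lambda>e. q - {e}) ` q"
        then obtain u v where uv: "(u, v) \<in> q" "p = q - {(u, v)}" by auto
        then have "p \<in> ?P" using remove[OF q] by blast
        moreover have "?R p q" using uv by (intro exI[of _ "(u, v)"]) auto
        ultimately show "p \<in> {p\<in>?P. ?R p q}" by blast
      qed
    qed
    finally show "real (l * (z + 1)) \<le> real (card {p\<in>?P. ?R p q})" by (simp only: of_nat_le_iff)
    fix e
    have "{p\<in>?P. ?R p q \<and> split_input l p e \<noteq> split_input l q e} \<subseteq> {q - {(Min e, Max e)}}"
      using diff_q[OF _ q] by blast
    then have "card {p\<in>?P. ?R p q \<and> split_input l p e \<noteq> split_input l q e} \<le> card {q - {(Min e, Max e)}}"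
      by (intro card_mono) auto
    then show "real (card {p\<in>?P. ?R p q \<and> split_input l p e \<noteq> split_input l q e}) \<le> 1" by simp
  next
    let ?Z = "{..<l} \<times> {l..<l + z + 1}"
    have "?Z `` {u} = {l..<l + z + 1}" if "u < l" for u using that by auto
    moreover have "?Z \<subseteq> ?B" using l d_le_\<alpha> by (auto simp: z_def)
    ultimately have "?Z \<in> ?Q" by simp
    moreover have "(0, l) \<in> ?Z" using l(1) by auto
    ultimately have "?Z - {(0, l)} \<in> ?P" by (rule remove)
    then show "?P \<noteq> {}" by blast
  qed (use l in \<open>auto intro: add_pos_nonneg\<close>)
  moreover have "real l * real (d + 1 - l) \<le> real (d + 1 - l) * real (l * (z + 1))"
  proof -
    have "l * (d + 1 - l) \<le> (d + 1 - l) * (l * (z + 1))" by simp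
    then show ?thesis by (simp only: of_nat_mult[symmetric] of_nat_le_iff)
  qed
  then have "sqrt (real l * real (d + 1 - l)) \<le> sqrt (real (d + 1 - l) * real (l * (z + 1)) / (1 * 1))"
    by (intro real_sqrt_le_mono) simp
  ultimately show ?thesis by linarith
qed

end

section \<open>Star forests\<close>

text \<open>Bijections between matching fibres glue because the fibres partition \<open>R\<close>.
  This yields the relabelling of leaves between forests with equal star sizes.\<close>

lemma ex_bij_betw_same_fibers:
  assumes "finite R" and "\<And>c. card {v\<in>R. g v = c} = card {v\<in>R. g' v = c}"
  obtains \<pi> where "bij_betw \<pi> R R" "\<And>v. v \<in> R \<Longrightarrow> g' (\<pi> v) = g v"
proof -
  have "\<forall>c. \<exists>h. bij_betw h {v\<in>R. g v = c} {v\<in>R. g' v = c}"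
    using assms by (auto intro!: finite_same_card_bij)
  then obtain h where h: "\<And>c. bij_betw (h c) {v\<in>R. g v = c} {v\<in>R. g' v = c}" by metis
  define \<pi> where "\<pi> v = h (g v) v" for v
  have \<pi>: "\<pi> v \<in> R \<and> g' (\<pi> v) = g v" if "v \<in> R" for v
    using bij_betw_apply[OF h[of "g v"], of v] that by (simp add: \<pi>_def)
  have "inj_on \<pi> R"
  proof (rule inj_onI)
    fix u v assume uv: "u \<in> R" "v \<in> R" "\<pi> u = \<pi> v"
    then have "g u = g v" using \<pi> by metis
    then show "u = v" using uv inj_onD[OF bij_betw_imp_inj_on[OF h[of "g v"]], of u v]
      by (simp add: \<pi>_def)
  qed
  moreover have "\<pi> ` R \<subseteq> R" using \<pi> by blast
  ultimately have "bij_betw \<pi> R R" using assms(1) by (simp add: bij_betw_def endo_inj_surj)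
  then show ?thesis using \<pi> that by blast
qed

context max_indep_set
begin

text \<open>A map \<open>g\<close> from leaves in \<open>{l..\<alpha>}\<close> to centres below \<open>l\<close> encodes a star forest on
  \<open>{..\<alpha>}\<close>; the remaining vertices are joined to everything.\<close>
definition forest_input :: "(nat \<rightharpoonup> nat) \<Rightarrow> nat set \<Rightarrow> bool" where
  "forest_input g e \<longleftrightarrow> (\<exists>t\<in>e. \<alpha> < t) \<or> (\<exists>v c. g v = Some c \<and> e = {c, v})"

definition forests :: "nat \<Rightarrow> (nat \<Rightarrow> nat) \<Rightarrow> (nat \<rightharpoonup> nat) set" where
  "forests l s = {g. dom g \<subseteq> {l..\<alpha>} \<and> ran g \<subseteq> {..<l} \<and> (\<forall>c<l. card {v. g v = Some c} = s c)}"

lemma finite_forests: "finite (forests l s)"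
proof -
  have "forests l s \<subseteq> (\<Union>D\<in>Pow {l..\<alpha>}. {g. dom g = D \<and> ran g \<subseteq> {..<l}})"
    by (auto simp: forests_def)
  moreover have "finite (\<Union>D\<in>Pow {l..\<alpha>}. {g. dom g = D \<and> ran g \<subseteq> {..<l}})"
    by (intro finite_UN_I finite_set_of_finite_maps) (auto intro: finite_subset)
  ultimately show ?thesis by (rule finite_subset)
qed

lemma finite_forest_fiber: "g \<in> forests l s \<Longrightarrow> finite {v. g v = Some c}"
  by (rule finite_subset[of _ "{l..\<alpha>}"]) (auto simp: forests_def)

lemma card_dom_forest:
  assumes g: "g \<in> forests l s"
  shows "card (dom g) = (\<Sum>c<l. s c)"
proof -
  have "dom g = (\<Union>c\<in>{..<l}. {v. g v = Some c})"
    using g by (fastforce simp: forests_def ran_def)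
  then have "card (dom g) = (\<Sum>c<l. card {v. g v = Some c})"
    using finite_forest_fiber[OF g] by (simp, subst card_UN_disjoint) auto
  then show ?thesis using g by (simp add: forests_def)
qed

lemma card_free_leaves:
  assumes "g \<in> forests l s"
  shows "card {v\<in>{l..\<alpha>}. g v = None} = \<alpha> + 1 - l - (\<Sum>c<l. s c)"
proof -
  have sub: "dom g \<subseteq> {l..\<alpha>}" using assms by (simp add: forests_def)
  have "{v\<in>{l..\<alpha>}. g v = None} = {l..\<alpha>} - dom g" by auto
  then show ?thesis
    using sub card_dom_forest[OF assms] by (simp add: card_Diff_subset finite_subset[OF sub])
qed

lemma forests_add_leaf:
  assumes g: "g \<in> forests l s" and c: "c < l" and v: "v \<in> {l..\<alpha>}" "g v = None"
  shows "g(v \<mapsto> c) \<in> forests l (s(c := Suc (s c)))"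
proof -
  have "{w. (g(v \<mapsto> c)) w = Some c'} = (if c' = c then insert v {w. g w = Some c} else {w. g w = Some c'})" for c'
    using v by auto
  moreover have "v \<notin> {w. g w = Some c}" using v by simp
  moreover have "ran (g(v \<mapsto> c)) = insert c (ran g)" using v by simp
  ultimately show ?thesis
    using assms finite_forest_fiber[OF g] by (auto simp: forests_def)
qed

lemma forests_remove_leaf:
  assumes g: "g \<in> forests l (s(c := Suc (s c)))" and v: "g v = Some c"
  shows "g(v := None) \<in> forests l s"
proof -
  have "{w. (g(v := None)) w = Some c'} = (if c' = c then {w. g w = Some c} - {v} else {w. g w = Some c'})" for c'
    using v by auto
  moreover have "v \<in> {w. g w = Some c}" using v by simp
  moreover have "ran (g(v := None)) \<subseteq> ran g" by (auto simp: ran_def)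
  moreover have "dom (g(v := None)) \<subseteq> dom g" by auto
  ultimately show ?thesis
    using assms finite_forest_fiber[OF g] by (auto simp: forests_def)
qed

lemma forest_input_mono: "g \<subseteq>\<^sub>m g' \<Longrightarrow> forest_input g e \<Longrightarrow> forest_input g' e"
  unfolding forest_input_def map_le_def by (metis domI)

lemma f_sub_forest_mono:
  assumes "g \<subseteq>\<^sub>m g'" "f_sub n H (forest_input g)"
  shows "f_sub n H (forest_input g')"
  by (rule f_sub_mono[OF H_edges _ assms(2)]) (rule forest_input_mono[OF assms(1)])

lemma forests_extend:
  assumes "g \<in> forests l s" "c < l" "(\<Sum>c<l. s c) + i \<le> \<alpha> + 1 - l"
  shows "\<exists>g'\<in>forests l (s(c := s c + i)). g \<subseteq>\<^sub>m g'"
  using assms(3)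
proof (induction i)
  case 0
  then show ?case using assms(1) by (auto intro!: bexI[of _ g])
next
  case (Suc i)
  then have "(\<Sum>c<l. s c) + i \<le> \<alpha> + 1 - l" by simp
  from Suc.IH[OF this] obtain g' where g': "g' \<in> forests l (s(c := s c + i))" "g \<subseteq>\<^sub>m g'"
    by blast
  have "(\<Sum>c'<l. (s(c := s c + i)) c') = (\<Sum>c<l. s c) + i"
    using assms(2) by (simp add: sum.remove[of "{..<l}" c])
  then have "card {v\<in>{l..\<alpha>}. g' v = None} > 0"
    using card_free_leaves[OF g'(1)] Suc.prems by simp
  then obtain v where v: "v \<in> {l..\<alpha>}" "g' v = None" by (auto simp: card_gt_0_iff)
  have "g'(v \<mapsto> c) \<in> forests l (s(c := s c + Suc i))"
    using forests_add_leaf[OF g'(1) assms(2) v] by simp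
  moreover have "g \<subseteq>\<^sub>m g'(v \<mapsto> c)"
    using g'(2) v by (auto simp: map_le_def dom_def)
  ultimately show ?case by blast
qed

text \<open>Equal star sizes allow a permutation of the leaves that carries one forest to the other
  and fixes the centres and the dominating vertices.\<close>

lemma f_sub_forest_cong:
  assumes g: "g \<in> forests l s" and g': "g' \<in> forests l s" and f: "f_sub n H (forest_input g)"
  shows "f_sub n H (forest_input g')"
proof -
  have n: "\<alpha> < n" using n_eq r_pos by simp
  have fibers: "card {v\<in>{l..\<alpha>}. g v = c} = card {v\<in>{l..\<alpha>}. g' v = c}" for c
  proof (cases c)
    case None
    then show ?thesis using card_free_leaves[OF g] card_free_leaves[OF g'] by simp
  next
    case (Some c')
    have "{v\<in>{l..\<alpha>}. h v = Some c'} = {v. h v = Some c'}" if "h \<in> forests l s" for h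
      using that by (auto simp: forests_def)
    moreover have "card {v. h v = Some c'} = (if c' < l then s c' else 0)" if "h \<in> forests l s" for h
    proof (cases "c' < l")
      case False
      then have "{v. h v = Some c'} = {}" using that by (auto simp: forests_def ran_def)
      with False show ?thesis by simp
    qed (use that in \<open>simp add: forests_def\<close>)
    ultimately show ?thesis using Some g g' by simp
  qed
  obtain \<pi> where \<pi>: "bij_betw \<pi> {l..\<alpha>} {l..\<alpha>}" "\<And>v. v \<in> {l..\<alpha>} \<Longrightarrow> g' (\<pi> v) = g v"
    using ex_bij_betw_same_fibers[of "{l..\<alpha>}" g g'] fibers by blast
  define \<rho> where "\<rho> v = (if v \<in> {l..\<alpha>} then \<pi> v else v)" for v
  have "bij_betw \<rho> {l..\<alpha>} {l..\<alpha>}"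
    using \<pi>(1) by (rule bij_betw_cong[THEN iffD1, rotated]) (simp add: \<rho>_def)
  moreover have "bij_betw \<rho> ({..<n} - {l..\<alpha>}) ({..<n} - {l..\<alpha>})"
    by (rule bij_betw_cong[THEN iffD1, rotated, OF bij_betw_id]) (auto simp: \<rho>_def)
  ultimately have "bij_betw \<rho> ({l..\<alpha>} \<union> ({..<n} - {l..\<alpha>})) ({l..\<alpha>} \<union> ({..<n} - {l..\<alpha>}))"
    by (rule bij_betw_combine) auto
  moreover have "{l..\<alpha>} \<union> ({..<n} - {l..\<alpha>}) = {..<n}" using n by auto
  ultimately have \<rho>: "bij_betw \<rho> {..<n} {..<n}" by simp
  have \<pi>_in: "\<pi> v \<in> {l..\<alpha>}" if "v \<in> {l..\<alpha>}" for v using \<pi>(1) that by (rule bij_betw_apply)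
  show ?thesis
  proof (rule f_sub_transfer[OF H_edges _ _ _ f])
    show "inj_on \<rho> {..<n}" "\<rho> ` {..<n} \<subseteq> {..<n}" using \<rho> by (auto simp: bij_betw_def)
    fix u v assume e: "forest_input g {u, v}"
    then consider "\<alpha> < u \<or> \<alpha> < v" | w c where "g w = Some c" "{u, v} = {c, w}"
      by (auto simp: forest_input_def)
    then show "forest_input g' {\<rho> u, \<rho> v}"
    proof cases
      case 1
      then show ?thesis by (auto simp: forest_input_def \<rho>_def)
    next
      case 2
      then have "w \<in> {l..\<alpha>}" "c < l" using g by (auto simp: forests_def ran_def)
      then have "g' (\<rho> w) = Some c" "\<rho> c = c" using \<pi>(2) 2 by (auto simp: \<rho>_def)
      moreover have "{\<rho> u, \<rho> v} = {\<rho> c, \<rho> w}" using 2(2) by (auto simp: doubleton_eq_iff)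
      ultimately show ?thesis unfolding forest_input_def by metis
    qed
  qed
qed

text \<open>The \<open>r - 1\<close> vertices above \<alpha> serve as the dominating set of
  \<open>f_sub_star\<close>, and the centre \<open>c\<close> as its vertex of degree at least
  \<open>d\<close>.\<close>

lemma f_sub_forest_star:
  assumes g: "g \<in> forests l s" and c: "c < l" "s c \<ge> d" and l: "l \<le> \<alpha>"
  shows "f_sub n H (forest_input g)"
proof -
  have n: "\<alpha> < n" using n_eq r_pos by simp
  have leaves: "{v. g v = Some c} \<subseteq> {l..\<alpha>}" using g by (auto simp: forests_def)
  show ?thesis
  proof (rule f_sub_star[of "{\<alpha><..<n}" _ c "{v. g v = Some c}"])
    show "{v. g v = Some c} \<subseteq> {..<n} - {\<alpha><..<n} - {c}" using leaves c n by auto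
    show "d \<le> card {v. g v = Some c}" using g c by (simp add: forests_def)
    show "forest_input g {c, u}" if "u \<in> {v. g v = Some c}" for u
      using that by (auto simp: forest_input_def)
  qed (use c l n n_eq r_pos in \<open>auto simp: forest_input_def\<close>)
qed

section \<open>Greedy choice of the star sizes\<close>

definition forest_zero :: "nat \<Rightarrow> (nat \<Rightarrow> nat) \<Rightarrow> bool" where
  "forest_zero l s \<longleftrightarrow> (\<forall>g\<in>forests l s. \<not> f_sub n H (forest_input g))"

text \<open>By \<open>f_sub_forest_cong\<close> the value depends on the star sizes only, so one
  forest decides for all.\<close>

lemma not_forest_zeroD:
  assumes "\<not> forest_zero l s" and g: "g \<in> forests l s"
  shows "f_sub n H (forest_input g)"
proof -
  obtain h where "h \<in> forests l s" "f_sub n H (forest_input h)"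
    using assms(1) unfolding forest_zero_def by blast
  then show ?thesis using g by (intro f_sub_forest_cong[of h l s g])
qed

text \<open>The first \<open>k\<close> stars are saturated: one more leaf at any of them creates
  \<open>H\<close>. Requiring \<open>forests l s \<noteq> {}\<close> excludes a vacuous
  \<open>forest_zero l s\<close>.\<close>

definition critical :: "nat \<Rightarrow> nat \<Rightarrow> (nat \<Rightarrow> nat) \<Rightarrow> bool" where
  "critical l k s \<longleftrightarrow> (\<forall>c\<ge>k. s c = 0) \<and> forests l s \<noteq> {} \<and> forest_zero l s
     \<and> (\<forall>c<k. \<not> forest_zero l (s(c := Suc (s c))))"

lemma critical_0: "critical l 0 (\<lambda>_. 0)"
proof -
  have n: "\<alpha> < n" using n_eq r_pos by simp
  have empty: "Map.empty \<in> forests l (\<lambda>_. 0)" by (simp add: forests_def)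
  have "\<not> f_sub n H (forest_input Map.empty)"
    using n by (intro not_f_sub_indep[of "{..\<alpha>}"]) (auto simp: forest_input_def)
  then have "forest_zero l (\<lambda>_. 0)" using empty not_forest_zeroD by blast
  then show ?thesis using empty by (auto simp: critical_def)
qed

text \<open>Centre \<open>k\<close> gets the largest size that does not create \<open>H\<close>; it
  is below \<open>d\<close> because a star with \<open>d\<close> leaves creates \<open>H\<close>.
  Earlier centres stay saturated, as containing \<open>H\<close> is monotone; \<open>room\<close>
  ensures that the larger forests exist.\<close>

lemma critical_extend:
  assumes crit: "critical l k s" and k: "k < l" and l: "l \<le> \<alpha>"
    and room: "(\<Sum>c<l. s c) + d \<le> \<alpha> + 1 - l"
  shows "\<exists>j\<le>d. critical l (Suc k) (s(k := j))"
proof -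
  have sk: "s k = 0" and zero: "forest_zero l s"
    and crit_c: "\<And>c. c < k \<Longrightarrow> \<not> forest_zero l (s(c := Suc (s c)))"
    using crit by (auto simp: critical_def)
  obtain g where g: "g \<in> forests l s" using crit by (auto simp: critical_def)
  have ex: "\<exists>g'. g' \<in> forests l (s(k := i))" if "i \<le> d" for i
    using forests_extend[OF g k, of i] room that sk by auto
  have one_d: "\<not> forest_zero l (s(k := d))"
    using ex[of d] f_sub_forest_star[of _ l "s(k := d)" k] k l by (auto simp: forest_zero_def)
  define i0 where "i0 = (LEAST i. \<not> forest_zero l (s(k := i)))"
  have i0: "\<not> forest_zero l (s(k := i0))" unfolding i0_def using one_d by (rule LeastI)
  have i0_le: "i0 \<le> d" unfolding i0_def using one_d by (rule Least_le)
  have "i0 \<noteq> 0" using i0 zero sk by (metis fun_upd_triv)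
  then obtain j where j: "i0 = Suc j" using not0_implies_Suc by blast
  have zero_j: "forest_zero l (s(k := j))"
    using not_less_Least[of j "\<lambda>i. \<not> forest_zero l (s(k := i))"] j unfolding i0_def by auto
  have "\<not> forest_zero l ((s(k := j))(c := Suc ((s(k := j)) c)))" if "c < Suc k" for c
  proof (cases "c = k")
    case True
    then show ?thesis using i0 j by simp
  next
    case False
    then have c: "c < k" "c < l" using that k by auto
    \<comment> \<open>A forest with one extra leaf at \<open>c\<close> already contains
      \<open>H\<close>; adding \<open>j\<close> leaves at \<open>k\<close> preserves this.\<close>
    obtain h where h: "h \<in> forests l (s(c := Suc (s c)))" "f_sub n H (forest_input h)"
      using crit_c[OF c(1)] by (auto simp: forest_zero_def)
    have "(\<Sum>c'<l. (s(c := Suc (s c))) c') = Suc (\<Sum>c<l. s c)"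
      using c(2) by (simp add: sum.remove[of "{..<l}" c])
    then have "(\<Sum>c'<l. (s(c := Suc (s c))) c') + j \<le> \<alpha> + 1 - l" using room i0_le j by simp
    from forests_extend[OF h(1) k this]
    obtain h' where h'': "h' \<in> forests l ((s(c := Suc (s c)))(k := (s(c := Suc (s c))) k + j))"
      and h': "h \<subseteq>\<^sub>m h'" by blast
    have "(s(c := Suc (s c))) k + j = j" using False sk by simp
    note h'' = h''[unfolded this]
    have "f_sub n H (forest_input h')" using f_sub_forest_mono[OF h' h(2)] .
    moreover have "(s(c := Suc (s c)))(k := j) = (s(k := j))(c := Suc ((s(k := j)) c))"
      using False by auto
    ultimately show ?thesis using h'' by (metis forest_zero_def)
  qed
  then have "critical l (Suc k) (s(k := j))"
    using zero_j ex[of j] i0_le j crit by (auto simp: critical_def)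
  then show ?thesis using i0_le j by (intro exI[of _ j]) simp
qed

text \<open>Saturate one centre after another until the sum of \<open>s c + 1\<close> reaches
  \<open>N\<close>. Each centre adds at least 1, so \<open>N\<close> centres suffice, and before
  each round there are fewer than \<open>N\<close> leaves, so the total exceeds \<open>N\<close> by
  at most \<open>d\<close>.\<close>

lemma ex_critical:
  assumes "N \<le> l" "l \<le> \<alpha>" "N + d \<le> \<alpha> + 1 - l"
  obtains k s where "k \<le> l" "critical l k s" "N \<le> (\<Sum>c<k. s c + 1)" "(\<Sum>c<l. s c) \<le> N + d"
proof -
  have "\<exists>k\<le>j. \<exists>s. critical l k s \<and> (N \<le> (\<Sum>c<k. s c + 1) \<or> k = j) \<and> (\<Sum>c<l. s c) \<le> N + d"
    if "j \<le> N" for j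
    using that
  proof (induction j)
    case 0
    then show ?case using critical_0 by (intro exI[of _ 0] conjI exI[of _ "\<lambda>_. 0"]) auto
  next
    case (Suc j)
    then obtain k s where ks: "k \<le> j" "critical l k s" "N \<le> (\<Sum>c<k. s c + 1) \<or> k = j"
      "(\<Sum>c<l. s c) \<le> N + d" by auto
    show ?case
    proof (cases "N \<le> (\<Sum>c<k. s c + 1)")
      case True
      then show ?thesis using ks by (intro exI[of _ k]) auto
    next
      case False
      then have kj: "k = j" and kl: "k < l" using ks Suc.prems assms(1) by auto
      have zero: "s c = 0" if "c \<ge> k" for c using ks(2) that by (auto simp: critical_def)
      have "(\<Sum>c<l. s c) = (\<Sum>c<k. s c)"
        using kl zero by (intro sum.mono_neutral_right) auto
      also have "\<dots> \<le> (\<Sum>c<k. s c + 1)" by (intro sum_mono) simp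
      finally have less: "(\<Sum>c<l. s c) < N" using False by simp
      obtain i where i: "i \<le> d" "critical l (Suc k) (s(k := i))"
        using critical_extend[OF ks(2) kl assms(2)] less assms(3) by auto
      have "(\<Sum>c<l. (s(k := i)) c) = (\<Sum>c<l. s c) + i"
        using kl zero[of k] by (simp add: sum.remove[of "{..<l}" k])
      then have "(\<Sum>c<l. (s(k := i)) c) \<le> N + d" using less i by simp
      then show ?thesis using i(2) kj by blast
    qed
  qed
  from this[of N] obtain k s where ks: "k \<le> N" "critical l k s" "N \<le> (\<Sum>c<k. s c + 1) \<or> k = N"
    "(\<Sum>c<l. s c) \<le> N + d" by auto
  have "k \<le> (\<Sum>c<k. s c + 1)" using sum_mono[of "{..<k}" "\<lambda>_. 1" "\<lambda>c. s c + 1"] by simp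
  then show ?thesis using ks assms(1) by (intro that[of k s]) auto
qed

lemma forest_input_add_leaf_diff:
  assumes "g v = None" "c < v" "forest_input (g(v \<mapsto> c)) e \<noteq> forest_input g e"
  shows "v = Max e" "c = Min e"
proof -
  have "g \<subseteq>\<^sub>m g(v \<mapsto> c)" using assms(1) by (auto simp: map_le_def)
  then have "forest_input (g(v \<mapsto> c)) e" "\<not> forest_input g e"
    using assms(3) forest_input_mono by blast+
  then have "e = {c, v}" by (auto simp: forest_input_def split: if_splits)
  then show "v = Max e" "c = Min e" using assms(2) by auto
qed

text \<open>A pair whose star at \<open>c\<close> grows has weight
  \<open>\<delta> c = s c + 1\<close>, the number of ways to shrink that star again. Thus each
  larger forest has row weight at least \<open>(\<delta> c)\<^sup>2\<close>, and each smaller one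
  has column weight at least \<open>F\<close> times the sum of all \<open>\<delta> c\<close>, hence
  at least \<open>F * N\<close>.\<close>

lemma forest_bound:
  assumes comp: "qcomputes (all_edges n) (f_sub n H) Tq"
    and N: "1 \<le> N" "N \<le> l" "l \<le> \<alpha>" and F: "1 \<le> F" "N + d + F \<le> \<alpha> + 1 - l"
  shows "1 \<le> 18 * real Tq * (1 / real \<alpha> + real \<alpha> / (real F * real N))"
proof -
  obtain k s where k: "k \<le> l" and crit: "critical l k s" and N_le: "N \<le> (\<Sum>c<k. s c + 1)"
    and total: "(\<Sum>c<l. s c) \<le> N + d"
    using ex_critical[of N l] N F by auto
  \<comment> \<open>In the final sum \<open>1 / D + D / (F * N)\<close>, this balances both terms up
    to constants when \<open>F\<close> and \<open>N\<close> are of order \<alpha>.\<close>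
  define D where "D = real \<alpha>"
  define \<delta> where "\<delta> c = real (s c + 1)" for c
  define up where "up c = forests l (s(c := Suc (s c)))" for c
  define P where "P = Sigma {..<k} up"
  define Q where "Q = forests l s"
  define R where "R p q \<longleftrightarrow> (\<exists>v\<in>{l..\<alpha>}. q v = None \<and> snd p = q(v \<mapsto> fst p))"
    for p :: "nat \<times> (nat \<rightharpoonup> nat)" and q :: "nat \<rightharpoonup> nat"
  define w where "w p q = (if R p q then \<delta> (fst p) else 0)" for p q
  define S where "S = (\<Sum>p\<in>P. \<Sum>q\<in>Q. w p q)"
  have D: "D > 0" unfolding D_def using N by simp
  have finQ: "finite Q" and finup: "finite (up c)" and finP: "finite P" for c
    by (auto simp: Q_def P_def up_def finite_forests)
  have diff: "q = (snd p)(Max e := None)" "p = (Min e, q(Max e \<mapsto> Min e))"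
    if pq: "p \<in> P" "R p q" "forest_input (snd p) e \<noteq> forest_input q e" for p q e
  proof -
    obtain v where v: "v \<in> {l..\<alpha>}" "q v = None" "snd p = q(v \<mapsto> fst p)" using pq(2) by (auto simp: R_def)
    have "fst p < v" using pq(1) k v(1) by (auto simp: P_def)
    then have "v = Max e" "fst p = Min e"
      using forest_input_add_leaf_diff[of q v "fst p" e] v pq(3) by auto
    then show "q = (snd p)(Max e := None)" "p = (Min e, q(Max e \<mapsto> Min e))"
      using v by (auto simp: prod_eq_iff fun_upd_idem)
  qed
  have main: "S \<le> 18 * real Tq * ((\<Sum>p\<in>P. (\<delta> (fst p))\<^sup>2 / D) + (\<Sum>q\<in>Q. D))"
    unfolding S_def
  proof (rule weighted_adversary_bound[where X = "\<lambda>p. forest_input (snd p)" and Y = forest_input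
        and a = "\<lambda>p q. if R p q then (\<delta> (fst p))\<^sup>2 / D else 0" and b = "\<lambda>p q. if R p q then D else 0"
        and A = "\<lambda>p. (\<delta> (fst p))\<^sup>2 / D" and B = "\<lambda>q. D" and w = w, OF finite_all_edges finP finQ comp])
    fix p assume "p \<in> P"
    then show "f_sub n H (forest_input (snd p))"
      using crit not_forest_zeroD by (auto simp: P_def up_def critical_def)
  next
    fix q assume "q \<in> Q"
    then show "\<not> f_sub n H (forest_input q)" using crit by (auto simp: Q_def critical_def forest_zero_def)
  next
    fix p e assume p: "p \<in> P"
    have "(\<Sum>q\<in>Q. if forest_input (snd p) e \<noteq> forest_input q e then if R p q then (\<delta> (fst p))\<^sup>2 / D else 0 else 0)
      \<le> (\<Sum>q\<in>Q. if q = (snd p)(Max e := None) then (\<delta> (fst p))\<^sup>2 / D else 0)"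
      using diff(1)[OF p] D by (intro sum_mono) auto
    also have "\<dots> \<le> (\<delta> (fst p))\<^sup>2 / D" using finQ D by simp
    finally show "(\<Sum>q\<in>Q. if forest_input (snd p) e \<noteq> forest_input q e then if R p q then (\<delta> (fst p))\<^sup>2 / D else 0 else 0)
      \<le> (\<delta> (fst p))\<^sup>2 / D" .
  next
    fix q e
    have "(\<Sum>p\<in>P. if forest_input (snd p) e \<noteq> forest_input q e then if R p q then D else 0 else 0)
      \<le> (\<Sum>p\<in>P. if p = (Min e, q(Max e \<mapsto> Min e)) then D else 0)"
      using diff(2) D by (intro sum_mono) auto
    also have "\<dots> \<le> D" using finP D by simp
    finally show "(\<Sum>p\<in>P. if forest_input (snd p) e \<noteq> forest_input q e then if R p q then D else 0 else 0) \<le> D" .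
  qed (use D in \<open>auto simp: w_def \<delta>_def\<close>)
  have A_le: "(\<Sum>p\<in>P. (\<delta> (fst p))\<^sup>2 / D) \<le> S / D"
  proof -
    have "(\<delta> (fst p))\<^sup>2 \<le> (\<Sum>q\<in>Q. w p q)" if p: "p \<in> P" for p
    proof -
      obtain c g where cg: "p = (c, g)" "c < k" "g \<in> up c" using p by (auto simp: P_def)
      have "s c + 1 = card {v. g v = Some c}" using cg k by (auto simp: up_def forests_def)
      also have "\<dots> = card ((\<lambda>v. g(v := None)) ` {v. g v = Some c})"
      proof (intro card_image[symmetric] inj_onI)
        fix u v assume u: "u \<in> {v. g v = Some c}" and eq: "g(u := None) = g(v := None)"
        have "(g(u := None)) u = (g(v := None)) u" using eq by (rule fun_cong)
        with u show "u = v" by (cases "u = v") simp_all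
      qed
      also have "\<dots> \<le> card {q\<in>Q. R p q}"
      proof (rule card_mono)
        show "(\<lambda>v. g(v := None)) ` {v. g v = Some c} \<subseteq> {q\<in>Q. R p q}"
        proof
          fix q assume "q \<in> (\<lambda>v. g(v := None)) ` {v. g v = Some c}"
          then obtain v where v: "g v = Some c" "q = g(v := None)" by auto
          have "q \<in> Q" unfolding Q_def v(2) using forests_remove_leaf cg(3) v(1) by (simp add: up_def)
          moreover have "v \<in> {l..\<alpha>}" using cg(3) v(1) by (auto simp: up_def forests_def)
          then have "R p q" unfolding R_def using v cg(1) by (intro bexI[of _ v]) (auto simp: fun_upd_idem)
          ultimately show "q \<in> {q\<in>Q. R p q}" by simp
        qed
      qed (use finQ in simp)
      finally have "\<delta> c * \<delta> c \<le> \<delta> c * real (card {q\<in>Q. R p q})"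
        unfolding \<delta>_def by (intro mult_left_mono) (simp_all only: of_nat_le_iff of_nat_0_le_iff)
      also have "\<dots> = (\<Sum>q\<in>Q. w p q)"
        unfolding w_def sum.inter_filter[OF finQ, symmetric] by (simp add: cg(1) mult.commute)
      finally show ?thesis by (simp add: cg(1) power2_eq_square)
    qed
    then have "(\<Sum>p\<in>P. (\<delta> (fst p))\<^sup>2) / D \<le> S / D"
      unfolding S_def using D by (intro divide_right_mono sum_mono) auto
    then show ?thesis by (simp add: sum_divide_distrib)
  qed
  have count: "real (card Q) * (real F * real N) \<le> S"
  proof -
    have "real F * real N \<le> (\<Sum>p\<in>P. w p q)" if q: "q \<in> Q" for q
    proof -
      \<comment> \<open>At most \<open>N + d\<close> leaves are in use, so at least \<open>F\<close>
        are free for any of the centres.\<close>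
      have many: "F \<le> card {g\<in>up c. R (c, g) q}" if c: "c < k" for c
      proof -
        have "F \<le> card {v\<in>{l..\<alpha>}. q v = None}"
          using card_free_leaves[of q l s] q total F(2) by (simp add: Q_def)
        also have "\<dots> = card ((\<lambda>v. q(v \<mapsto> c)) ` {v\<in>{l..\<alpha>}. q v = None})"
        proof (intro card_image[symmetric] inj_onI)
          fix u v assume u: "u \<in> {v\<in>{l..\<alpha>}. q v = None}" and eq: "q(u \<mapsto> c) = q(v \<mapsto> c)"
          have "(q(u \<mapsto> c)) u = (q(v \<mapsto> c)) u" using eq by (rule fun_cong)
          with u show "u = v" by (cases "u = v") simp_all
        qed
        also have "\<dots> \<le> card {g\<in>up c. R (c, g) q}"
          using finup[of c] q c k forests_add_leaf[of q l s c]
          by (intro card_mono) (auto simp: up_def Q_def R_def)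
        finally show ?thesis .
      qed
      have "real F * real N \<le> real F * (\<Sum>c<k. \<delta> c)"
        using N_le by (intro mult_left_mono) (simp_all add: \<delta>_def flip: of_nat_sum of_nat_Suc)
      also have "\<dots> = (\<Sum>c<k. \<delta> c * real F)" by (simp add: sum_distrib_left mult.commute)
      also have "\<dots> \<le> (\<Sum>c<k. \<delta> c * real (card {g\<in>up c. R (c, g) q}))"
        using many by (intro sum_mono mult_left_mono) (auto simp: \<delta>_def)
      also have "\<dots> = (\<Sum>c<k. \<Sum>g\<in>up c. w (c, g) q)"
        unfolding w_def sum.inter_filter[OF finup, symmetric] by (simp add: mult.commute)
      also have "\<dots> = (\<Sum>p\<in>P. w p q)"
        unfolding P_def using finup by (subst sum.Sigma) (auto simp: case_prod_beta)
      finally show ?thesis .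
    qed
    then have "(\<Sum>q\<in>Q. real F * real N) \<le> (\<Sum>q\<in>Q. \<Sum>p\<in>P. w p q)" by (rule sum_mono)
    then show ?thesis unfolding S_def by (subst sum.swap) simp
  qed
  note main
  also have "18 * real Tq * ((\<Sum>p\<in>P. (\<delta> (fst p))\<^sup>2 / D) + (\<Sum>q\<in>Q. D))
      \<le> 18 * real Tq * (S / D + real (card Q) * D)"
    using A_le by (intro mult_left_mono add_mono) auto
  also have "\<dots> \<le> 18 * real Tq * (S / D + S / (real F * real N) * D)"
    using count N F D by (intro mult_left_mono add_left_mono mult_right_mono) (auto simp: field_simps)
  also have "\<dots> = S * (18 * real Tq * (1 / D + D / (real F * real N)))" by (simp add: field_simps)
  finally have "S * 1 \<le> S * (18 * real Tq * (1 / D + D / (real F * real N)))" by simp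
  moreover have "S > 0"
  proof -
    have "card Q > 0" using crit finQ by (auto simp: critical_def Q_def card_gt_0_iff)
    then have "real (card Q) * (real F * real N) > 0" using N F by simp
    then show ?thesis using count by linarith
  qed
  ultimately show ?thesis unfolding D_def by (simp only: mult_le_cancel_left_pos)
qed

end

section \<open>The lower bound\<close>

text \<open>The four cases give the factors 144, 10, 288 and 1755 in front of \<open>Tq\<close>, all
  below 2000.\<close>

lemma (in max_indep_set) sqrt_\<alpha>_n_le:
  assumes comp: "qcomputes (all_edges n) (f_sub n H) Tq"
  shows "sqrt (real \<alpha> * real n) \<le> 2000 * real Tq"
proof -
  have dom: "sqrt (real r * real (\<alpha> + 1) / 2) \<le> 36 * real Tq"
    using comp by (rule dominating_sets_bound)
  consider "\<alpha> \<le> 4 * r" | "4 * r < \<alpha>" "\<alpha> < 8" | "4 * r < \<alpha>" "8 \<le> \<alpha>" "\<alpha> \<le> 2 * d"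
    | "4 * r < \<alpha>" "8 \<le> \<alpha>" "2 * d < \<alpha>"
    by linarith
  then show ?thesis
  proof cases
    case 1
    have "\<alpha> * n \<le> (\<alpha> + 1) * (5 * r)" using 1 n_eq by (intro mult_mono) auto
    then have "real (\<alpha> * n) \<le> real ((\<alpha> + 1) * (5 * r))" by (simp only: of_nat_le_iff)
    also have "\<dots> \<le> 4\<^sup>2 * (real r * real (\<alpha> + 1) / 2)" by (simp add: algebra_simps)
    finally have "sqrt (real \<alpha> * real n) \<le> sqrt (4\<^sup>2 * (real r * real (\<alpha> + 1) / 2))"
      by (intro real_sqrt_le_mono) simp
    also have "\<dots> = 4 * sqrt (real r * real (\<alpha> + 1) / 2)"
      by (subst real_sqrt_mult) simp
    finally show ?thesis using dom by linarith
  next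
    case 2
    \<comment> \<open>For small \<alpha> the values of \<open>l\<close> used below may be 0. Here a
      single query suffices, and positivity of the first bound forces one.\<close>
    have "sqrt (real r * real (\<alpha> + 1) / 2) > 0" using r_pos by simp
    then have "Tq \<ge> 1" using dom by (cases Tq) auto
    have "\<alpha> * n \<le> 10 * 10" using 2 n_eq by (intro mult_mono) auto
    then have "real (\<alpha> * n) \<le> real (10 * 10)" by (simp only: of_nat_le_iff)
    then have "sqrt (real \<alpha> * real n) \<le> sqrt (10\<^sup>2)" by (intro real_sqrt_le_mono) simp
    then show ?thesis using \<open>Tq \<ge> 1\<close> by simp
  next
    case 3
    \<comment> \<open>Then \<open>l + r\<close> is below \<alpha>/2 and so at most \<open>d\<close>,
      while \<open>d + 1 - l\<close> is at least \<alpha>/4; both factors of the bound are of order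
      \<alpha>.\<close>
    define l where "l = \<alpha> div 4"
    have l: "l \<ge> 1" "4 * l \<le> \<alpha>" "\<alpha> \<le> 8 * l" using 3(2) unfolding l_def by presburger+
    have bound: "sqrt (real l * real (d + 1 - l)) \<le> 36 * real Tq"
      using 3 l by (intro split_input_bound[OF comp]) auto
    have "\<alpha> * n \<le> (8 * l) * (2 * (4 * (d + 1 - l)))" using 3 l n_eq by (intro mult_mono) auto
    then have "real (\<alpha> * n) \<le> real ((8 * l) * (2 * (4 * (d + 1 - l))))" by (simp only: of_nat_le_iff)
    also have "\<dots> = 8\<^sup>2 * (real l * real (d + 1 - l))" by simp
    finally have "sqrt (real \<alpha> * real n) \<le> sqrt (8\<^sup>2 * (real l * real (d + 1 - l)))"
      by (intro real_sqrt_le_mono) simp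
    also have "\<dots> = 8 * sqrt (real l * real (d + 1 - l))"
      by (subst real_sqrt_mult) simp
    finally show ?thesis using bound by linarith
  next
    case 4
    \<comment> \<open>This serves both as the number of centres and as \<open>N\<close>. As
      \<open>d\<close> is below \<alpha>/2, at least \<alpha>/4 leaves remain for \<open>F\<close>,
      so \<open>F * l\<close> is at least \<alpha> squared over 64.\<close>
    define l where "l = \<alpha> div 8"
    define F where "F = \<alpha> + 1 - l - (l + d)"
    have l: "l \<ge> 1" "8 * l \<le> \<alpha>" "\<alpha> \<le> 16 * l" using 4(2) unfolding l_def by presburger+
    have F: "F \<ge> 1" "\<alpha> \<le> 4 * F" using 4 l unfolding F_def by auto
    have \<alpha>: "real \<alpha> > 0" using 4 by simp
    have "1 \<le> 18 * real Tq * (1 / real \<alpha> + real \<alpha> / (real F * real l))"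
      using l F 4 by (intro forest_bound[OF comp, where N = l and l = l]) (auto simp: F_def)
    also have "\<dots> \<le> 18 * real Tq * (1 / real \<alpha> + 64 / real \<alpha>)"
    proof (intro mult_left_mono add_left_mono)
      have "\<alpha> * \<alpha> \<le> (4 * F) * (16 * l)" using l F by (intro mult_mono) auto
      then have "real (\<alpha> * \<alpha>) \<le> real ((4 * F) * (16 * l))" by (simp only: of_nat_le_iff)
      then show "real \<alpha> / (real F * real l) \<le> 64 / real \<alpha>"
        using \<alpha> F l by (simp add: divide_simps mult_ac)
    qed auto
    also have "\<dots> = 1170 * real Tq / real \<alpha>" by (simp add: field_simps)
    finally have T: "real \<alpha> \<le> 1170 * real Tq" using \<alpha> by (simp add: field_simps)
    have "4 * n \<le> 5 * \<alpha>" using 4 n_eq by simp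
    then have "real \<alpha> * (4 * real n) \<le> real \<alpha> * (5 * real \<alpha>)" by (intro mult_left_mono) linarith+
    then have "real \<alpha> * real n \<le> ((3/2) * real \<alpha>)\<^sup>2"
      using \<alpha> by (simp add: power2_eq_square)
    then have "sqrt (real \<alpha> * real n) \<le> (3/2) * real \<alpha>" using \<alpha> by (intro real_le_lsqrt) auto
    then show ?thesis using T by linarith
  qed
qed

lemma indep_number_attained:
  obtains A where "A \<subseteq> {..<n}" "\<And>u v. u \<in> A \<Longrightarrow> v \<in> A \<Longrightarrow> {u, v} \<notin> H" "card A = indep_number n H"
    and "\<And>S. S \<subseteq> {..<n} \<Longrightarrow> (\<And>u v. u \<in> S \<Longrightarrow> v \<in> S \<Longrightarrow> {u, v} \<notin> H) \<Longrightarrow> card S \<le> card A"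
proof -
  let ?I = "{card S | S. S \<subseteq> {..<n} \<and> (\<forall>u\<in>S. \<forall>v\<in>S. {u, v} \<notin> H)}"
  have fin: "finite ?I"
    by (rule finite_subset[of _ "{..n}"]) (auto dest: card_mono[OF finite_lessThan])
  have "card ({} :: nat set) \<in> ?I" by blast
  then have "Max ?I \<in> ?I" using fin by (intro Max_in) blast+
  then obtain A where A: "A \<subseteq> {..<n}" "\<forall>u\<in>A. \<forall>v\<in>A. {u, v} \<notin> H" "card A = Max ?I" by force
  moreover have "card S \<le> card A" if "S \<subseteq> {..<n}" "\<And>u v. u \<in> S \<Longrightarrow> v \<in> S \<Longrightarrow> {u, v} \<notin> H" for S
    unfolding A(3) using fin that by (intro Max_ge) blast+
  ultimately show ?thesis using that by (simp add: indep_number_def)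
qed

theorem theorem1:
  shows "\<exists>c::real. c > 0 \<and>
    (\<forall>n::nat. \<forall>H. n \<ge> 2 \<longrightarrow> H \<subseteq> all_edges n \<longrightarrow> H \<noteq> {} \<longrightarrow>
       real (Qcomplexity (all_edges n) (f_sub n H))
         \<ge> c * sqrt (real (indep_number n H) * real n))"
proof (intro exI[of _ "1 / 2000"] conjI allI impI)
  fix n :: nat and H :: "nat set set"
  assume H: "H \<subseteq> all_edges n" "H \<noteq> {}"
  obtain A where A: "A \<subseteq> {..<n}" "\<And>u v. u \<in> A \<Longrightarrow> v \<in> A \<Longrightarrow> {u, v} \<notin> H" "card A = indep_number n H"
    "\<And>S. S \<subseteq> {..<n} \<Longrightarrow> (\<And>u v. u \<in> S \<Longrightarrow> v \<in> S \<Longrightarrow> {u, v} \<notin> H) \<Longrightarrow> card S \<le> card A"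
    by (rule indep_number_attained[of n H]) (rule that; blast)
  interpret max_indep_set n H A by unfold_locales (use H A in auto)
  show "real (Qcomplexity (all_edges n) (f_sub n H)) \<ge> 1 / 2000 * sqrt (real (indep_number n H) * real n)"
    using sqrt_\<alpha>_n_le[OF qcomputes_Qcomplexity[OF H(1)]] A(3) by (simp add: \<alpha>_def)
qed simp

end
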